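(* $\mathrm{EF}$ model checking is decidable for gap-order constraint systems: given a GCS $\mathcal{G}$, a valuation $\nu$ and an $\mathrm{EF}$ formula $\psi$, it is decidable whether $\nu\in[\![\psi]\!]$. Moreover, for every $\mathrm{EF}$ formula $\psi$ the set $[\![\psi]\!]$ is effectively gap definable, i.e.\ a gap formula $\varphi$ with $\mathit{Sat}(\varphi)=[\![\psi]\!]$ can be computed from $\mathcal{G}$ and $\psi$.
   Context: Fix finite sets $\mathit{Var}$ of variables (ranging over $\mathbb{Z}$) and $\mathit{Const}\subseteq\mathbb{Z}$ of constants. A valuation is a map $\nu:\mathit{Var}\to\mathbb{Z}$, extended by $\nu(c)=c$ for constants; $\mathit{Val}$ is the set of valuations. A gap clause is an inequation $x-y\ge k$ with $x,y\in\mathit{Var}\cup\mathit{Const}$, $k\in\mathbb{Z}$; positive if $k\in\mathbb{N}$; $\nu$ satisfies it iff $\nu(x)-\nu(y)\ge k$. A gap formula is an arbitrary Boolean combination of gap clauses; $\mathit{Sat}(\varphi)$ is the set of valuations satisfying it; a set is gap definable if it equals $\mathit{Sat}(\varphi)$ for some gap formula $\varphi$. A (positive) gap constraint is a finite conjunction of (positive) gap clauses. Let $\mathit{Var}'=\{x'\mid x\in\mathit{Var}\}$; a transitional gap constraint is one over $\mathit{Var}\cup\mathit{Var}'$, and $\nu\oplus\nu'$ maps $x\mapsto\nu(x)$, $x'\mapsto\nu'(x)$. A GCS is $\mathcal{G}=(\mathit{Var},\mathit{Const},\mathit{Act},\Delta,\lambda)$ with finite action set $\mathit{Act}$, finite set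 $\Delta$ of positive transitional gap constraints and $\lambda:\Delta\to\mathit{Act}$; its semantics is the transition system on $\mathit{Val}$ with $\nu\xrightarrow{a}\nu'$ iff $\nu\oplus\nu'$ satisfies some $C\in\Delta$ with $\lambda(C)=a$. $\mathrm{EF}$ formulae: $\psi::=C\mid\mathit{true}\mid\neg\psi\mid\psi\wedge\psi\mid\langle a\rangle\psi\mid\mathrm{EF}\,\psi$ with $C$ a gap clause and $a\in\mathit{Act}$. Semantics: $[\![C]\!]=\mathit{Sat}(C)$, $[\![\mathit{true}]\!]=\mathit{Val}$, negation/conjunction are complement/intersection, $[\![\langle a\rangle\psi]\!]=\{\nu\mid\exists\nu'\in[\![\psi]\!].\ \nu\xrightarrow{a}\nu'\}$, and $[\![\mathrm{EF}\,\psi]\!]$ is the set of $\nu$ from which some valuation in $[\![\psi]\!]$ is reachable by a finite (possibly empty) sequence of steps. *)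

theory Defs
  imports Main "HOL-Library.FuncSet" "HOL-Library.Nat_Bijection"
begin

section \<open>Gap clauses and gap formulas\<close>

datatype 'v gterm = V 'v | K int

text \<open>\<open>Gap s t k\<close> is the clause \<open>s - t \<ge> k\<close>.\<close>

datatype 'v clause = Gap "'v gterm" "'v gterm" int

text \<open>A gap constraint is a finite conjunction of clauses, given by the list of its conjuncts.\<close>

type_synonym 'v gconstraint = "'v clause list"

text \<open>
  The constant \<open>GTrue\<close> is the empty Boolean combination.  It is redundant unless there are neither
  variables nor constants, in which case no gap clause exists at all.
\<close>

datatype 'v gform =
    GTrue
  | GClause "'v clause"
  | GNot "'v gform"
  | GAnd "'v gform" "'v gform"

primrec term_over :: "'v set \<Rightarrow> int set \<Rightarrow> 'v gterm \<Rightarrow> bool" where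
  "term_over X D (V x) \<longleftrightarrow> x \<in> X"
| "term_over X D (K c) \<longleftrightarrow> c \<in> D"

primrec clause_over :: "'v set \<Rightarrow> int set \<Rightarrow> 'v clause \<Rightarrow> bool" where
  "clause_over X D (Gap s t k) \<longleftrightarrow> term_over X D s \<and> term_over X D t"

primrec gform_over :: "'v set \<Rightarrow> int set \<Rightarrow> 'v gform \<Rightarrow> bool" where
  "gform_over X D GTrue \<longleftrightarrow> True"
| "gform_over X D (GClause c) \<longleftrightarrow> clause_over X D c"
| "gform_over X D (GNot \<phi>) \<longleftrightarrow> gform_over X D \<phi>"
| "gform_over X D (GAnd \<phi> \<chi>) \<longleftrightarrow> gform_over X D \<phi> \<and> gform_over X D \<chi>"

primrec positive_clause :: "'v clause \<Rightarrow> bool" where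
  "positive_clause (Gap s t k) \<longleftrightarrow> k \<ge> 0"

primrec term_val :: "('v \<Rightarrow> int) \<Rightarrow> 'v gterm \<Rightarrow> int" where
  "term_val \<nu> (V x) = \<nu> x"
| "term_val \<nu> (K c) = c"

primrec sat_clause :: "('v \<Rightarrow> int) \<Rightarrow> 'v clause \<Rightarrow> bool" where
  "sat_clause \<nu> (Gap s t k) \<longleftrightarrow> term_val \<nu> s - term_val \<nu> t \<ge> k"

definition sat_constraint :: "('v \<Rightarrow> int) \<Rightarrow> 'v gconstraint \<Rightarrow> bool" where
  "sat_constraint \<nu> C \<longleftrightarrow> (\<forall>c\<in>set C. sat_clause \<nu> c)"

primrec sat_gform :: "('v \<Rightarrow> int) \<Rightarrow> 'v gform \<Rightarrow> bool" where
  "sat_gform \<nu> GTrue \<longleftrightarrow> True"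
| "sat_gform \<nu> (GClause c) \<longleftrightarrow> sat_clause \<nu> c"
| "sat_gform \<nu> (GNot \<phi>) \<longleftrightarrow> \<not> sat_gform \<nu> \<phi>"
| "sat_gform \<nu> (GAnd \<phi> \<chi>) \<longleftrightarrow> sat_gform \<nu> \<phi> \<and> sat_gform \<nu> \<chi>"

text \<open>
  A valuation of a set \<open>X\<close> of variables is a function on \<open>X\<close>, i.e. one that takes the dummy value
  \<open>undefined\<close> outside \<open>X\<close>.
\<close>

definition Val :: "'v set \<Rightarrow> ('v \<Rightarrow> int) set" where
  "Val X = X \<rightarrow>\<^sub>E UNIV"

definition Sat :: "'v set \<Rightarrow> 'v gform \<Rightarrow> ('v \<Rightarrow> int) set" where
  "Sat X \<phi> = {\<nu> \<in> Val X. sat_gform \<nu> \<phi>}"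


section \<open>Gap-order constraint systems\<close>

datatype 'v tvar = Cur 'v | Nxt 'v

definition oplus :: "('v \<Rightarrow> int) \<Rightarrow> ('v \<Rightarrow> int) \<Rightarrow> 'v tvar \<Rightarrow> int" where
  "oplus \<nu> \<nu>' = case_tvar \<nu> \<nu>'"

record ('v, 'a) gcs =
  vars :: "'v set"
  constants :: "int set"
  acts :: "'a set"
  rules :: "'v tvar gconstraint set"
  label :: "'v tvar gconstraint \<Rightarrow> 'a"

definition is_gcs :: "('v, 'a) gcs \<Rightarrow> bool" where
  "is_gcs G \<longleftrightarrow> finite (vars G) \<and> finite (constants G) \<and> finite (acts G) \<and> finite (rules G) \<and>
     (\<forall>C\<in>rules G. label G C \<in> acts G \<and>
        (\<forall>c\<in>set C. clause_over (Cur ` vars G \<union> Nxt ` vars G) (constants G) c \<and> positive_clause c))"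

definition step :: "('v, 'a) gcs \<Rightarrow> 'a \<Rightarrow> ('v \<Rightarrow> int) \<Rightarrow> ('v \<Rightarrow> int) \<Rightarrow> bool" where
  "step G a \<nu> \<nu>' \<longleftrightarrow> \<nu> \<in> Val (vars G) \<and> \<nu>' \<in> Val (vars G) \<and>
     (\<exists>C\<in>rules G. label G C = a \<and> sat_constraint (oplus \<nu> \<nu>') C)"

definition reach :: "('v, 'a) gcs \<Rightarrow> ('v \<Rightarrow> int) \<Rightarrow> ('v \<Rightarrow> int) \<Rightarrow> bool" where
  "reach G = (\<lambda>\<nu> \<nu>'. \<exists>a\<in>acts G. step G a \<nu> \<nu>')\<^sup>*\<^sup>*"


section \<open>The logic EF\<close>

datatype ('v, 'a) ef =
    EClause "'v clause"
  | ETrue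
  | ENot "('v, 'a) ef"
  | EAnd "('v, 'a) ef" "('v, 'a) ef"
  | EDia 'a "('v, 'a) ef"
  | EF "('v, 'a) ef"

primrec ef_over :: "('v, 'a) gcs \<Rightarrow> ('v, 'a) ef \<Rightarrow> bool" where
  "ef_over G (EClause c) \<longleftrightarrow> clause_over (vars G) (constants G) c"
| "ef_over G ETrue \<longleftrightarrow> True"
| "ef_over G (ENot \<psi>) \<longleftrightarrow> ef_over G \<psi>"
| "ef_over G (EAnd \<psi> \<chi>) \<longleftrightarrow> ef_over G \<psi> \<and> ef_over G \<chi>"
| "ef_over G (EDia a \<psi>) \<longleftrightarrow> a \<in> acts G \<and> ef_over G \<psi>"
| "ef_over G (EF \<psi>) \<longleftrightarrow> ef_over G \<psi>"

primrec sem :: "('v, 'a) gcs \<Rightarrow> ('v, 'a) ef \<Rightarrow> ('v \<Rightarrow> int) set" where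
  "sem G (EClause c) = {\<nu> \<in> Val (vars G). sat_clause \<nu> c}"
| "sem G ETrue = Val (vars G)"
| "sem G (ENot \<psi>) = Val (vars G) - sem G \<psi>"
| "sem G (EAnd \<psi> \<chi>) = sem G \<psi> \<inter> sem G \<chi>"
| "sem G (EDia a \<psi>) = {\<nu> \<in> Val (vars G). \<exists>\<nu>'\<in>sem G \<psi>. step G a \<nu> \<nu>'}"
| "sem G (EF \<psi>) = {\<nu> \<in> Val (vars G). \<exists>\<nu>'\<in>sem G \<psi>. reach G \<nu> \<nu>'}"


section \<open>Partial recursive functions\<close>

text \<open>
  The unary partial recursive functions; several arguments are passed through the Cantor pairing
  \<open>prod_encode\<close>.  Unbounded minimisation requires the function to be defined, and nonzero, at all
  points before the zero that is found.
\<close>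

definition minimise :: "(nat \<Rightarrow> nat option) \<Rightarrow> nat option" where
  "minimise h =
     (if \<exists>k. h k = Some 0 \<and> (\<forall>j<k. \<exists>y. h j = Some (Suc y)) then Some (LEAST k. h k = Some 0)
      else None)"

inductive partial_recursive :: "(nat \<Rightarrow> nat option) \<Rightarrow> bool" where
  zero: "partial_recursive (\<lambda>n. Some 0)"
| succ: "partial_recursive (\<lambda>n. Some (Suc n))"
| left: "partial_recursive (\<lambda>n. Some (fst (prod_decode n)))"
| right: "partial_recursive (\<lambda>n. Some (snd (prod_decode n)))"
| pair: "partial_recursive f \<Longrightarrow> partial_recursive g \<Longrightarrow>
    partial_recursive (\<lambda>n. Option.bind (f n) (\<lambda>x. Option.bind (g n) (\<lambda>y. Some (prod_encode (x, y)))))"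
| comp: "partial_recursive f \<Longrightarrow> partial_recursive g \<Longrightarrow>
    partial_recursive (\<lambda>n. Option.bind (g n) f)"
| prec: "partial_recursive f \<Longrightarrow> partial_recursive g \<Longrightarrow>
    partial_recursive (\<lambda>n. rec_nat (f (fst (prod_decode n)))
      (\<lambda>k r. Option.bind r (\<lambda>y. g (prod_encode (fst (prod_decode n), prod_encode (k, y)))))
      (snd (prod_decode n)))"
| mu: "partial_recursive f \<Longrightarrow>
    partial_recursive (\<lambda>n. minimise (\<lambda>k. f (prod_encode (n, k))))"

definition total_recursive :: "(nat \<Rightarrow> nat) \<Rightarrow> bool" where
  "total_recursive f \<longleftrightarrow> partial_recursive (\<lambda>n. Some (f n))"


section \<open>Goedel numbers\<close>

primrec term_code :: "('v \<Rightarrow> nat) \<Rightarrow> 'v gterm \<Rightarrow> nat" where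
  "term_code e (V x) = sum_encode (Inl (e x))"
| "term_code e (K c) = sum_encode (Inr (int_encode c))"

primrec clause_code :: "('v \<Rightarrow> nat) \<Rightarrow> 'v clause \<Rightarrow> nat" where
  "clause_code e (Gap s t k) =
     prod_encode (term_code e s, prod_encode (term_code e t, int_encode k))"

primrec tvar_code :: "nat tvar \<Rightarrow> nat" where
  "tvar_code (Cur x) = sum_encode (Inl x)"
| "tvar_code (Nxt x) = sum_encode (Inr x)"

definition tconstraint_code :: "nat tvar gconstraint \<Rightarrow> nat" where
  "tconstraint_code C = list_encode (map (clause_code tvar_code) C)"

primrec gform_code :: "nat gform \<Rightarrow> nat" where
  "gform_code GTrue = prod_encode (0, 0)"
| "gform_code (GClause c) = prod_encode (1, clause_code id c)"
| "gform_code (GNot \<phi>) = prod_encode (2, gform_code \<phi>)"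
| "gform_code (GAnd \<phi> \<chi>) = prod_encode (3, prod_encode (gform_code \<phi>, gform_code \<chi>))"

primrec ef_code :: "(nat, nat) ef \<Rightarrow> nat" where
  "ef_code (EClause c) = prod_encode (0, clause_code id c)"
| "ef_code ETrue = prod_encode (1, 0)"
| "ef_code (ENot \<psi>) = prod_encode (2, ef_code \<psi>)"
| "ef_code (EAnd \<psi> \<chi>) = prod_encode (3, prod_encode (ef_code \<psi>, ef_code \<chi>))"
| "ef_code (EDia a \<psi>) = prod_encode (4, prod_encode (a, ef_code \<psi>))"
| "ef_code (EF \<psi>) = prod_encode (5, ef_code \<psi>)"

text \<open>
  The finite sets of a system, and the finite graphs of valuations and labelling functions, are
  presented by lists in any order and with any repetitions.  Hence these objects have many codes, and
  an algorithm has to be correct on all of them.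
\<close>

definition codes_gcs :: "nat \<Rightarrow> (nat, nat) gcs \<Rightarrow> bool" where
  "codes_gcs n G \<longleftrightarrow> (\<exists>xs cs as Cs.
     set xs = vars G \<and> set cs = constants G \<and> set as = acts G \<and> set Cs = rules G \<and>
     n = prod_encode (list_encode xs, prod_encode (list_encode (map int_encode cs),
           prod_encode (list_encode as,
             list_encode (map (\<lambda>C. prod_encode (tconstraint_code C, label G C)) Cs)))))"

definition codes_val :: "nat \<Rightarrow> nat set \<Rightarrow> (nat \<Rightarrow> int) \<Rightarrow> bool" where
  "codes_val n X \<nu> \<longleftrightarrow> (\<exists>xs. set xs = X \<and>
     n = list_encode (map (\<lambda>x. prod_encode (x, int_encode (\<nu> x))) xs))"

text \<open>The codes are unambiguous.\<close>

lemma term_code_inj: "inj e \<Longrightarrow> term_code e s = term_code e t \<longleftrightarrow> s = t"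
  by (cases s; cases t) (auto simp: inj_eq sum_encode_eq int_encode_eq)

lemma clause_code_inj: "inj e \<Longrightarrow> clause_code e c = clause_code e d \<longleftrightarrow> c = d"
  by (cases c; cases d) (auto simp: term_code_inj int_encode_eq)

lemma tvar_code_inj: "inj tvar_code"
proof (rule injI)
  fix x y assume "tvar_code x = tvar_code y"
  then show "x = y" by (cases x; cases y) (auto simp: sum_encode_eq)
qed

lemma tconstraint_code_inj: "inj tconstraint_code"
proof (rule injI)
  have "inj (clause_code tvar_code)"
    by (rule injI) (simp add: clause_code_inj[OF tvar_code_inj])
  then show "C = D" if "tconstraint_code C = tconstraint_code D" for C D
    using that by (simp add: tconstraint_code_def list_encode_eq inj_map_eq_map)
qed

lemma gform_code_inj: "gform_code \<phi> = gform_code \<chi> \<longleftrightarrow> \<phi> = \<chi>"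
  by (induction \<phi> arbitrary: \<chi>; case_tac \<chi>) (auto simp: clause_code_inj)

lemma ef_code_inj: "ef_code \<psi> = ef_code \<chi> \<longleftrightarrow> \<psi> = \<chi>"
  by (induction \<psi> arbitrary: \<chi>; case_tac \<chi>) (auto simp: clause_code_inj)

lemma codes_val_unique:
  assumes "codes_val n X \<nu>" "codes_val n X \<nu>'" "\<nu> \<in> Val X" "\<nu>' \<in> Val X"
  shows "\<nu> = \<nu>'"
proof (rule extensionalityI)
  show "\<nu> \<in> extensional X" "\<nu>' \<in> extensional X"
    using assms by (auto simp: Val_def PiE_def)
  fix x assume "x \<in> X"
  moreover have "map (\<lambda>x. prod_encode (x, int_encode (\<nu> x))) xs = map (\<lambda>x. prod_encode (x, int_encode (\<nu>' x))) ys
    \<Longrightarrow> \<forall>x\<in>set xs. \<nu> x = \<nu>' x" for xs ys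
    by (induction xs arbitrary: ys) (auto simp: Cons_eq_map_conv int_encode_eq)
  ultimately show "\<nu> x = \<nu>' x"
    using assms(1,2) unfolding codes_val_def by (auto simp: list_encode_eq)
qed

lemma codes_gcs_unique:
  assumes "codes_gcs n G" "codes_gcs n H"
  shows "vars G = vars H \<and> constants G = constants H \<and> acts G = acts H \<and> rules G = rules H \<and>
    (\<forall>C\<in>rules G. label G C = label H C)"
proof -
  have *: "map (\<lambda>C. prod_encode (tconstraint_code C, label G C)) Cs =
      map (\<lambda>C. prod_encode (tconstraint_code C, label H C)) Ds
    \<Longrightarrow> Cs = Ds \<and> (\<forall>C\<in>set Cs. label G C = label H C)" for Cs Ds
    by (induction Cs arbitrary: Ds) (auto simp: Cons_eq_map_conv inj_eq[OF tconstraint_code_inj])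
  show ?thesis
    using assms unfolding codes_gcs_def
    by (auto dest!: * simp: list_encode_eq inj_map_eq_map[OF inj_int_encode])
qed

end

theory Submission
  imports Defs "HOL-Library.Infinite_Set"
begin

text \<open>
  Two valuations agree up to a threshold \<open>m\<close> if all differences of terms, truncated to \<open>[-m, m]\<close>, are the
  same.  Gap definable sets are the sets invariant under such an agreement, and a back-and-forth
  argument, which halves the threshold with each new variable, shows that predecessors of invariant
  sets are invariant.  For \<open>EF\<close>, a map on the integers that fixes the constants and does not
  decrease distances sends runs to runs, because all rules are positive.  If such a map is already
  prescribed on the first valuation of a run, and rigid there on distances up to a bound \<open>B\<close>, then it
  can be chosen rigid on the clusters of the last valuation, so that the end of the run stays in the
  invariant target set.  Hence the sets of valuations that reach the target within \<open>n\<close> steps are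
  upward closed under a stretching relation that admits no infinite bad sequence, and they stabilise.

  On the side of computability, a formula for the predecessors is found by unbounded search.  The
  test of a candidate is decidable because, by the same back-and-forth argument, it is enough to
  look at valuations with small values.
\<close>

section \<open>Total recursive functions\<close>

text \<open>Each application of \<open>Pre\<close> multiplies the threshold of invariance by
  \<open>2 ^ card X\<close>, so the thresholds of the iterated predecessors grow with the number of
  steps and give no reason for stabilisation. What stays uniform is the stretching bound
  \<open>B\<close>: it depends only on the threshold of the target and on the number of terms,
  because the map that transports a run has to be rigid only on the values of the last valuation,
  however long the run is. Upward closure under stretching is in general lost under complement, so
  it cannot be the property carried through nested formulas. That property is gap definability, and
  each \<open>EF\<close> derives a stretching relation afresh from the threshold of its own target.
  The argument by bad sequences yields no bound on the number of iterations. The program therefore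
  searches for the first iterate that is a fixpoint, and recognises it by the same finite test that
  validates candidates for predecessors. All bounds in this test are arithmetic expressions in the
  codes, because a code is at least as large as whatever it encodes.\<close>

definition p1 :: "nat \<Rightarrow> nat" where "p1 n = fst (prod_decode n)"
definition p2 :: "nat \<Rightarrow> nat" where "p2 n = snd (prod_decode n)"

lemma p1_pair [simp]: "p1 (prod_encode (a, b)) = a"
  and p2_pair [simp]: "p2 (prod_encode (a, b)) = b"
  by (simp_all add: p1_def p2_def)

lemma pair_p1_p2 [simp]: "prod_encode (p1 n, p2 n) = n"
  by (simp add: p1_def p2_def)

lemma p1_le: "p1 n \<le> n" and p2_le: "p2 n \<le> n"
  using le_prod_encode_1[of "p1 n" "p2 n"] le_prod_encode_2[of "p2 n" "p1 n"] by simp_all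

text \<open>With first component 0 the second one may equal \<open>n\<close>, as it does for
  \<open>n = 0\<close> and \<open>n = 1\<close>. All recursive constructors have nonzero tags, so
  this is the descent that justifies recursion on codes.\<close>

lemma p2_less: "p1 n \<noteq> 0 \<Longrightarrow> p2 n < n"
proof -
  assume *: "p1 n \<noteq> 0"
  have "p2 n \<le> triangle (p1 n + p2 n)"
    by (cases "p1 n + p2 n") auto
  then have "p2 n < triangle (p1 n + p2 n) + p1 n" using * by simp
  also have "\<dots> = n" using pair_p1_p2[of n] by (simp add: prod_encode_def)
  finally show ?thesis .
qed

abbreviation (input) "tr \<equiv> total_recursive"

lemma tr_p1: "tr p1"
  unfolding total_recursive_def p1_def by (rule left)

lemma tr_p2: "tr p2"
  unfolding total_recursive_def p2_def by (rule right)

lemma tr_compose: "tr f \<Longrightarrow> tr g \<Longrightarrow> tr (\<lambda>n. f (g n))"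
  unfolding total_recursive_def
  using comp[of "\<lambda>n. Some (f n)" "\<lambda>n. Some (g n)"] by simp

text \<open>The rules follow the syntax of an expression, so recursiveness can be read off a
  definition. A bound variable is paired with the parameter, whence the premises in
  \<open>p1 m\<close> and \<open>p2 m\<close>.\<close>

named_theorems tr_intros

lemma tr_p1I [tr_intros]: "tr f \<Longrightarrow> tr (\<lambda>n. p1 (f n))"
  by (rule tr_compose[OF tr_p1])

lemma tr_p2I [tr_intros]: "tr f \<Longrightarrow> tr (\<lambda>n. p2 (f n))"
  by (rule tr_compose[OF tr_p2])

lemma tr_Suc [tr_intros]: "tr f \<Longrightarrow> tr (\<lambda>n. Suc (f n))"
  by (rule tr_compose) (simp add: total_recursive_def succ)

lemma tr_pair [tr_intros]: "tr f \<Longrightarrow> tr g \<Longrightarrow> tr (\<lambda>n. prod_encode (f n, g n))"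
  unfolding total_recursive_def
  using pair[of "\<lambda>n. Some (f n)" "\<lambda>n. Some (g n)"] by simp

lemma tr_id [tr_intros]: "tr (\<lambda>n. n)"
  using tr_pair[OF tr_p1 tr_p2] by simp

lemma tr_const [tr_intros]: "tr (\<lambda>n. c)"
proof (induction c)
  case 0
  show ?case by (simp add: total_recursive_def zero)
qed (rule tr_Suc)

lemma tr_rec_nat [tr_intros]:
  assumes a: "tr a" and c: "tr c" and b: "tr (\<lambda>m. b (p1 m) (p1 (p2 m)) (p2 (p2 m)))"
  shows "tr (\<lambda>n. rec_nat (a n) (\<lambda>k y. b n k y) (c n))"
proof -
  have "rec_nat (Some (a n)) (\<lambda>k r. Option.bind r (\<lambda>y. Some (b n k y))) i =
      Some (rec_nat (a n) (b n) i)" for n i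
    by (induction i) auto
  then have "tr (\<lambda>m. rec_nat (a (p1 m)) (b (p1 m)) (p2 m))"
    using prec[OF a[unfolded total_recursive_def] b[unfolded total_recursive_def]]
    by (simp add: total_recursive_def flip: p1_def p2_def)
  from tr_compose[OF this tr_pair[OF tr_id c]] show ?thesis by simp
qed

lemma tr_compose2:
  assumes "tr (\<lambda>m. h (p1 m) (p2 m))" "tr f" "tr g"
  shows "tr (\<lambda>n. h (f n) (g n))"
  using tr_compose[OF assms(1) tr_pair[OF assms(2,3)]] by simp

lemma tr_compose3:
  assumes "tr (\<lambda>m. h (p1 m) (p1 (p2 m)) (p2 (p2 m)))" "tr f" "tr g" "tr k"
  shows "tr (\<lambda>n. h (f n) (g n) (k n))"
  using tr_compose[OF assms(1) tr_pair[OF assms(2) tr_pair[OF assms(3,4)]]] by simp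

lemma tr_add [tr_intros]:
  assumes "tr f" "tr g" shows "tr (\<lambda>n. f n + g n)"
proof -
  have *: "x + y = rec_nat x (\<lambda>k. Suc) y" for x y by (induction y) auto
  show ?thesis unfolding * by (intro tr_intros assms)
qed

lemma tr_mult [tr_intros]:
  assumes "tr f" "tr g" shows "tr (\<lambda>n. f n * g n)"
proof -
  have *: "x * y = rec_nat 0 (\<lambda>k z. z + x) y" for x y :: nat by (induction y) auto
  have "tr (\<lambda>m. p1 m * p2 m)" unfolding * by (intro tr_intros)
  then show ?thesis using assms by (rule tr_compose2)
qed

lemma tr_power [tr_intros]:
  assumes "tr f" "tr g" shows "tr (\<lambda>n. f n ^ g n)"
proof -
  have *: "x ^ y = rec_nat 1 (\<lambda>k z. z * x) y" for x y :: nat by (induction y) auto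
  have "tr (\<lambda>m. p1 m ^ p2 m)" unfolding * by (intro tr_intros)
  then show ?thesis using assms by (rule tr_compose2)
qed

lemma tr_pred: "tr f \<Longrightarrow> tr (\<lambda>n. f n - 1)"
proof -
  have *: "x - 1 = rec_nat 0 (\<lambda>k z. k) x" for x :: nat by (cases x) auto
  show "tr f \<Longrightarrow> ?thesis" unfolding * by (intro tr_intros)
qed

lemma tr_diff [tr_intros]:
  assumes "tr f" "tr g" shows "tr (\<lambda>n. f n - g n)"
proof -
  have *: "x - y = rec_nat x (\<lambda>k z. z - 1) y" for x y :: nat by (induction y) auto
  have "tr (\<lambda>m. rec_nat (f m) (\<lambda>k z. z - 1) (g m))"
    by (intro tr_intros tr_pred assms)
  then show ?thesis by (simp only: *[symmetric])
qed

definition decidable :: "(nat \<Rightarrow> bool) \<Rightarrow> bool" where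
  "decidable P \<longleftrightarrow> tr (\<lambda>n. of_bool (P n))"

lemma tr_of_bool [tr_intros]: "decidable P \<Longrightarrow> tr (\<lambda>n. of_bool (P n))"
  by (simp add: decidable_def)

lemma decidable_compose: "decidable P \<Longrightarrow> tr f \<Longrightarrow> decidable (\<lambda>n. P (f n))"
  unfolding decidable_def by (rule tr_compose)

lemma decidable_compose2:
  "decidable (\<lambda>m. P (p1 m) (p2 m)) \<Longrightarrow> tr f \<Longrightarrow> tr g \<Longrightarrow> decidable (\<lambda>n. P (f n) (g n))"
  unfolding decidable_def by (rule tr_compose2)

lemma decidable_zero: "tr f \<Longrightarrow> decidable (\<lambda>n. f n = 0)"
proof -
  assume f: "tr f"
  have *: "of_bool (x = 0) = 1 - x" for x :: nat by (cases x) auto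
  show ?thesis unfolding decidable_def * by (intro tr_intros f)
qed

lemma decidable_le [tr_intros]: "tr f \<Longrightarrow> tr g \<Longrightarrow> decidable (\<lambda>n. f n \<le> g n)"
  unfolding diff_is_0_eq[symmetric] by (intro decidable_zero tr_diff)

lemma decidable_not [tr_intros]: "decidable P \<Longrightarrow> decidable (\<lambda>n. \<not> P n)"
proof -
  have *: "of_bool (\<not> b) = 1 - (of_bool b :: nat)" for b by (cases b) auto
  assume "decidable P"
  then show ?thesis unfolding decidable_def[of "\<lambda>n. \<not> P n"] * by (intro tr_diff tr_const tr_of_bool)
qed

lemma decidable_conj [tr_intros]: "decidable P \<Longrightarrow> decidable Q \<Longrightarrow> decidable (\<lambda>n. P n \<and> Q n)"
  unfolding decidable_def of_bool_conj by (rule tr_mult)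

lemma decidable_disj [tr_intros]: "decidable P \<Longrightarrow> decidable Q \<Longrightarrow> decidable (\<lambda>n. P n \<or> Q n)"
proof -
  have *: "b \<or> c \<longleftrightarrow> \<not> (\<not> b \<and> \<not> c)" for b c by auto
  show "decidable P \<Longrightarrow> decidable Q \<Longrightarrow> ?thesis" unfolding * by (intro decidable_not decidable_conj)
qed

lemma decidable_imp [tr_intros]: "decidable P \<Longrightarrow> decidable Q \<Longrightarrow> decidable (\<lambda>n. P n \<longrightarrow> Q n)"
  unfolding imp_conv_disj by (intro decidable_not decidable_disj)

lemma decidable_eq [tr_intros]: "tr f \<Longrightarrow> tr g \<Longrightarrow> decidable (\<lambda>n. f n = g n)"
  unfolding order.eq_iff[where 'a = nat] by (intro decidable_conj decidable_le)

lemma decidable_less [tr_intros]: "tr f \<Longrightarrow> tr g \<Longrightarrow> decidable (\<lambda>n. f n < g n)"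
  unfolding not_le[symmetric] by (intro decidable_not decidable_le)

lemma decidable_iff [tr_intros]: "decidable P \<Longrightarrow> decidable Q \<Longrightarrow> decidable (\<lambda>n. P n \<longleftrightarrow> Q n)"
  unfolding iff_conv_conj_imp by (intro decidable_conj decidable_imp)

lemma tr_if [tr_intros]:
  assumes "decidable P" "tr f" "tr g"
  shows "tr (\<lambda>n. if P n then f n else g n)"
proof -
  have *: "(if P n then f n else g n) = of_bool (P n) * f n + of_bool (\<not> P n) * g n" for n
    by simp
  show ?thesis unfolding * by (intro tr_intros assms)
qed

lemma decidable_ball_less [tr_intros]:
  assumes "decidable (\<lambda>m. P (p1 m) (p2 m))" "tr f"
  shows "decidable (\<lambda>n. \<forall>k<f n. P n k)"
proof -
  have *: "of_bool (\<forall>k<i. P n k) = rec_nat (1 :: nat) (\<lambda>k z. z * of_bool (P n k)) i" for n i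
  proof (induction i)
    case (Suc i)
    have "(\<forall>k<Suc i. P n k) \<longleftrightarrow> (\<forall>k<i. P n k) \<and> P n i" by (auto simp: less_Suc_eq)
    then show ?case by (simp only: of_bool_conj Suc nat.rec)
  qed simp
  have "decidable (\<lambda>m. P (p1 m) (p1 (p2 m)))"
    by (rule decidable_compose2[OF assms(1)]) (intro tr_intros)+
  then show ?thesis
    unfolding decidable_def[of "\<lambda>n. \<forall>k<f n. P n k"] * by (intro tr_intros assms(2))
qed

lemma decidable_bex_less [tr_intros]:
  assumes "decidable (\<lambda>m. P (p1 m) (p2 m))" "tr f"
  shows "decidable (\<lambda>n. \<exists>k<f n. P n k)"
  using decidable_not[OF decidable_ball_less[OF decidable_not[OF assms(1)] assms(2)]] by simp

lemma decidable_ball_le [tr_intros]: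
  assumes "decidable (\<lambda>m. P (p1 m) (p2 m))" "tr f"
  shows "decidable (\<lambda>n. \<forall>k\<le>f n. P n k)"
  using decidable_ball_less[OF assms(1) tr_Suc[OF assms(2)]] by (simp add: less_Suc_eq_le)

lemma decidable_bex_le [tr_intros]:
  assumes "decidable (\<lambda>m. P (p1 m) (p2 m))" "tr f"
  shows "decidable (\<lambda>n. \<exists>k\<le>f n. P n k)"
  using decidable_bex_less[OF assms(1) tr_Suc[OF assms(2)]] by (simp add: less_Suc_eq_le)

text \<open>This is the only use of unbounded minimisation. The function minimised is total with
  values 0 and 1, so \<open>minimise\<close> is defined as soon as a witness exists.\<close>

lemma tr_Least:
  assumes "decidable (\<lambda>m. P (p1 m) (p2 m))" "\<And>n. \<exists>k. P n k"
  shows "tr (\<lambda>n. LEAST k. P n k)"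
proof -
  have "minimise (\<lambda>k. Some (of_bool (\<not> P n k))) = Some (LEAST k. P n k)" for n
  proof -
    obtain k where "P n k" "\<forall>j<k. \<not> P n j"
      using assms(2) exists_least_iff[of "P n"] by auto
    then show ?thesis by (auto simp: minimise_def)
  qed
  then show ?thesis
    using mu[OF decidable_not[OF assms(1), unfolded decidable_def total_recursive_def]]
    by (simp add: total_recursive_def)
qed

lemma tr_div2 [tr_intros]:
  assumes "tr f" shows "tr (\<lambda>n. f n div 2)"
proof -
  have *: "n div 2 = (LEAST k. n < 2 * k + 2)" for n :: nat
    by (rule sym, rule Least_equality) auto
  have "decidable (\<lambda>m. p1 m < 2 * p2 m + 2)" by (intro tr_intros)
  then have "tr (\<lambda>n. LEAST k. n < 2 * k + 2)"
    by (rule tr_Least[of "\<lambda>n k. n < 2 * k + 2"]) presburger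
  then have "tr (\<lambda>n. n div 2)" by (simp only: *[symmetric])
  from tr_compose[OF this assms] show ?thesis .
qed

lemma decidable_even [tr_intros]:
  assumes "tr f" shows "decidable (\<lambda>n. even (f n))"
proof -
  have *: "even m \<longleftrightarrow> m = 2 * (m div 2)" for m :: nat by presburger
  show ?thesis unfolding * by (intro tr_intros assms)
qed

section \<open>Coded lists and recursion on codes\<close>

text \<open>A nonempty list has code \<open>Suc (prod_encode (x, c))\<close> with \<open>c\<close>
  the code of its tail. The empty list has code 0, which \<open>p2 (y - 1)\<close> maps to itself,
  so dropping too many elements is harmless.\<close>

definition ldrop :: "nat \<Rightarrow> nat \<Rightarrow> nat" where
  "ldrop c i = rec_nat c (\<lambda>k y. p2 (y - 1)) i"

definition lnth :: "nat \<Rightarrow> nat \<Rightarrow> nat" where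
  "lnth c i = p1 (ldrop c i - 1)"

lemma ldrop_encode: "ldrop (list_encode l) i = list_encode (drop i l)"
proof (induction i)
  case (Suc i)
  have "p2 (list_encode xs - 1) = list_encode (tl xs)" for xs
    using p2_le[of 0] by (cases xs) simp_all
  with Suc show ?case by (simp add: ldrop_def drop_Suc tl_drop)
qed (simp add: ldrop_def)

lemma lnth_encode: "i < length l \<Longrightarrow> lnth (list_encode l) i = l ! i"
  by (simp add: lnth_def ldrop_encode flip: Cons_nth_drop_Suc)

lemma tr_ldrop [tr_intros]: "tr f \<Longrightarrow> tr g \<Longrightarrow> tr (\<lambda>n. ldrop (f n) (g n))"
  unfolding ldrop_def by (intro tr_intros)

lemma tr_lnth [tr_intros]: "tr f \<Longrightarrow> tr g \<Longrightarrow> tr (\<lambda>n. lnth (f n) (g n))"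
  unfolding lnth_def by (intro tr_intros)

lemma length_le_list_encode: "length l \<le> list_encode l"
proof (induction l)
  case (Cons x l)
  then show ?case using le_prod_encode_2[of "list_encode l" x] by simp
qed simp

lemma mem_le_list_encode: "x \<in> set l \<Longrightarrow> x < list_encode l"
proof (induction l)
  case (Cons y l)
  then show ?case
    using le_prod_encode_2[of "list_encode l" y] le_prod_encode_1[of y "list_encode l"] by auto
qed simp

abbreviation elems :: "nat \<Rightarrow> nat set" where "elems c \<equiv> set (list_decode c)"

lemma mem_elems_less: "x \<in> elems c \<Longrightarrow> x < c"
  using mem_le_list_encode[of x "list_decode c"] by simp

text \<open>A list is no longer than its code, so membership is a bounded search;
  \<open>ldrop c i\<close> is nonzero exactly at the positions inside the list.\<close>

lemma elems_iff: "x \<in> elems c \<longleftrightarrow> (\<exists>i<c. ldrop c i \<noteq> 0 \<and> x = lnth c i)"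
proof -
  define l where "l = list_decode c"
  have c: "c = list_encode l" by (simp add: l_def)
  have nz: "ldrop c i \<noteq> 0 \<longleftrightarrow> i < length l" for i
    using list_encode_eq[of "drop i l" "[]"] by (auto simp: c ldrop_encode simp del: list_encode_eq)
  have "i < length l \<Longrightarrow> i < c" for i
    using length_le_list_encode[of l] c by simp
  then have "x \<in> set l \<longleftrightarrow> (\<exists>i<c. i < length l \<and> x = l ! i)"
    by (auto simp: in_set_conv_nth)
  also have "\<dots> \<longleftrightarrow> (\<exists>i<c. i < length l \<and> x = lnth c i)"
    using lnth_encode[of _ l, folded c] by auto
  finally show ?thesis by (simp only: nz l_def)
qed

lemma decidable_Bex_elems [tr_intros]:
  assumes "decidable (\<lambda>m. P (p1 m) (p2 m))" "tr f"
  shows "decidable (\<lambda>n. \<exists>x\<in>elems (f n). P n x)"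
proof -
  have *: "(\<exists>x\<in>elems (f n). P n x) \<longleftrightarrow> (\<exists>i<f n. ldrop (f n) i \<noteq> 0 \<and> P n (lnth (f n) i))" for n
    using elems_iff by metis
  show ?thesis
    unfolding * using assms(2)
    by (intro tr_intros decidable_compose2[OF assms(1)]) (rule tr_compose[OF assms(2)], intro tr_intros)+
qed

lemma decidable_Ball_elems [tr_intros]:
  assumes "decidable (\<lambda>m. P (p1 m) (p2 m))" "tr f"
  shows "decidable (\<lambda>n. \<forall>x\<in>elems (f n). P n x)"
  using decidable_not[OF decidable_Bex_elems[OF decidable_not[OF assms(1)] assms(2)]] by simp

lemma decidable_mem_elems [tr_intros]:
  assumes "tr f" "tr g" shows "decidable (\<lambda>n. f n \<in> elems (g n))"
proof -
  have *: "x \<in> elems c \<longleftrightarrow> (\<exists>y\<in>elems c. x = y)" for x c by auto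
  have "tr (\<lambda>n. f (p1 n))" by (rule tr_compose[OF assms(1) tr_p1])
  then show ?thesis unfolding * by (intro tr_intros assms)
qed

text \<open>Course-of-values recursion becomes primitive recursion once the accumulator is the coded
  list of all earlier values. The locality premise allows this table, which is correct only below
  \<open>n\<close>, to stand in for \<open>f p\<close>.\<close>

lemma tr_course_of_values:
  assumes eq: "\<And>p n. f p n = F p n (f p)"
    and loc: "\<And>p n h h'. (\<And>i. i < n \<Longrightarrow> h i = h' i) \<Longrightarrow> F p n h = F p n h'"
    and F: "tr (\<lambda>m. F (p1 m) (p1 (p2 m)) (\<lambda>i. lnth (p2 (p2 m)) (p1 (p2 m) - Suc i)))"
  shows "tr (\<lambda>m. f (p1 m) (p2 m))"
proof -
  define H where "H p n =
    rec_nat 0 (\<lambda>k t. Suc (prod_encode (F p k (\<lambda>i. lnth t (k - Suc i)), t))) n" for p n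
  \<comment> \<open>The table of the values below \<open>n\<close> is in reverse order, whence the index \<open>n - Suc i\<close>.\<close>
  have H: "H p n = list_encode (map (f p) (rev [0..<n]))" for p n
  proof (induction n)
    case (Suc n)
    have "F p n (\<lambda>i. lnth (H p n) (n - Suc i)) = f p n"
      unfolding eq[of p n]
    proof (rule loc)
      fix i assume "i < n"
      then show "lnth (H p n) (n - Suc i) = f p i"
        by (subst Suc, subst lnth_encode) (auto simp: rev_nth)
    qed
    moreover have "H p (Suc n) = Suc (prod_encode (F p n (\<lambda>i. lnth (H p n) (n - Suc i)), H p n))"
      by (simp add: H_def)
    ultimately show ?case using Suc by simp
  qed (simp add: H_def)
  have "f p n = lnth (H p (Suc n)) 0" for p n
    by (simp add: H lnth_def ldrop_def)
  moreover have "tr (\<lambda>m. H (p1 m) (p2 m))"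
    unfolding H_def
    by (intro tr_intros)
      (rule tr_compose3[of "\<lambda>p k t. F p k (\<lambda>i. lnth t (k - Suc i))", OF F], (intro tr_intros)+)
  then have "tr (\<lambda>m. lnth (H (p1 m) (Suc (p2 m))) 0)"
    by (intro tr_intros) (rule tr_compose2, (assumption | intro tr_intros)+)
  ultimately show ?thesis by simp
qed

text \<open>Using differences of functions avoids arithmetic on the codes given by \<open>int_encode\<close>.\<close>

definition int_recursive :: "(nat \<Rightarrow> int) \<Rightarrow> bool" where
  "int_recursive f \<longleftrightarrow> (\<exists>a b. tr a \<and> tr b \<and> (\<forall>n. f n = int (a n) - int (b n)))"

lemma int_recursive_decode [tr_intros]:
  assumes "tr f" shows "int_recursive (\<lambda>n. int_decode (f n))"
proof -
  have "int_decode c = int (if even c then c div 2 else 0) - int (if even c then 0 else Suc (c div 2))" for c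
    by (simp add: int_decode_def sum_decode_def)
  then show ?thesis
    unfolding int_recursive_def
    by (intro exI[of _ "\<lambda>n. if even (f n) then f n div 2 else 0"]
        exI[of _ "\<lambda>n. if even (f n) then 0 else Suc (f n div 2)"] conjI allI)
      (intro tr_intros assms | simp)+
qed

lemma int_recursive_if [tr_intros]:
  assumes "decidable P" "int_recursive f" "int_recursive g"
  shows "int_recursive (\<lambda>n. if P n then f n else g n)"
proof -
  obtain a b c d where *: "tr a" "tr b" "tr c" "tr d" "\<And>n. f n = int (a n) - int (b n)"
      "\<And>n. g n = int (c n) - int (d n)"
    using assms unfolding int_recursive_def by auto
  have "tr (\<lambda>n. if P n then a n else c n)" "tr (\<lambda>n. if P n then b n else d n)"
    by (intro tr_intros *(1-4) assms(1))+
  moreover have "(if P n then f n else g n) =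
      int (if P n then a n else c n) - int (if P n then b n else d n)" for n
    by (simp add: *(5,6))
  ultimately show ?thesis unfolding int_recursive_def by blast
qed

lemma int_recursive_compose:
  assumes "int_recursive F" "tr g"
  shows "int_recursive (\<lambda>n. F (g n))"
proof -
  obtain a b where ab: "tr a" "tr b" "\<forall>n. F n = int (a n) - int (b n)"
    using assms(1) unfolding int_recursive_def by blast
  have "tr (\<lambda>n. a (g n))" "tr (\<lambda>n. b (g n))"
    by (rule tr_compose[OF ab(1) assms(2)], rule tr_compose[OF ab(2) assms(2)])
  with ab(3) show ?thesis unfolding int_recursive_def by blast
qed

lemma int_recursive_compose2:
  assumes "int_recursive (\<lambda>m. F (p1 m) (p2 m))" "tr f" "tr g"
  shows "int_recursive (\<lambda>n. F (f n) (g n))"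
  using int_recursive_compose[OF assms(1) tr_pair[OF assms(2,3)]] by simp

lemma decidable_int_diff [tr_intros]:
  assumes "int_recursive f" "int_recursive g" "int_recursive h"
  shows "decidable (\<lambda>n. h n \<le> f n - g n)"
proof -
  obtain a b where f: "tr a" "tr b" "\<And>n. f n = int (a n) - int (b n)"
    using assms(1) unfolding int_recursive_def by blast
  obtain c d where g: "tr c" "tr d" "\<And>n. g n = int (c n) - int (d n)"
    using assms(2) unfolding int_recursive_def by blast
  obtain u v where h: "tr u" "tr v" "\<And>n. h n = int (u n) - int (v n)"
    using assms(3) unfolding int_recursive_def by blast
  have *: "h n \<le> f n - g n \<longleftrightarrow> u n + b n + c n \<le> a n + d n + v n" for n
    unfolding f g h by linarith
  show ?thesis unfolding * by (intro tr_intros f(1,2) g(1,2) h(1,2))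
qed

section \<open>Agreement up to a threshold\<close>

definition clamp :: "int \<Rightarrow> int \<Rightarrow> int" where
  "clamp m d = max (- m) (min m d)"

definition agree :: "'v set \<Rightarrow> int set \<Rightarrow> int \<Rightarrow> ('v \<Rightarrow> int) \<Rightarrow> ('v \<Rightarrow> int) \<Rightarrow> bool" where
  "agree X D m \<nu> \<mu> \<longleftrightarrow> (\<forall>s t. term_over X D s \<longrightarrow> term_over X D t \<longrightarrow>
     clamp m (term_val \<nu> s - term_val \<nu> t) = clamp m (term_val \<mu> s - term_val \<mu> t))"

lemma clamp_ge: "0 \<le> m \<Longrightarrow> m \<le> d \<Longrightarrow> clamp m d = m"
  and clamp_le: "0 \<le> m \<Longrightarrow> d \<le> - m \<Longrightarrow> clamp m d = - m"
  by (simp_all add: clamp_def)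

text \<open>The truncated value \<open>- m\<close> does not tell \<open>d = - m\<close> from smaller
  \<open>d\<close>, so \<open>k = - m\<close> has to be excluded, whereas \<open>k = m\<close> is
  allowed. Hence the strict inequality in \<open>gap_bound\<close>.\<close>

lemma le_iff_clamp: "clamp m d = clamp m d' \<Longrightarrow> - m < k \<Longrightarrow> k \<le> m \<Longrightarrow> k \<le> d \<longleftrightarrow> k \<le> d'"
  unfolding clamp_def by linarith

lemma clamp_mono: "clamp m d = clamp m d' \<Longrightarrow> m' \<le> m \<Longrightarrow> clamp m' d = clamp m' d'"
  unfolding clamp_def by linarith

lemma agree_mono: "agree X D m \<nu> \<mu> \<Longrightarrow> m' \<le> m \<Longrightarrow> agree X D m' \<nu> \<mu>"
  unfolding agree_def using clamp_mono by blast

lemma agree_sym: "agree X D m \<nu> \<mu> \<Longrightarrow> agree X D m \<mu> \<nu>"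
  unfolding agree_def by metis

lemma term_val_cong: "\<forall>x\<in>X. \<nu> x = \<mu> x \<Longrightarrow> term_over X D s \<Longrightarrow> term_val \<nu> s = term_val \<mu> s"
  by (cases s) auto

lemma agree_cong: "\<forall>x\<in>X. \<nu> x = \<mu> x \<Longrightarrow> agree X D m \<nu> \<mu>"
  unfolding agree_def by (metis term_val_cong)

lemma sat_clause_agree:
  assumes "agree X D m \<nu> \<mu>" "clause_over X D (Gap s t k)" "\<bar>k\<bar> < m"
  shows "sat_clause \<nu> (Gap s t k) \<longleftrightarrow> sat_clause \<mu> (Gap s t k)"
proof -
  have "clamp m (term_val \<nu> s - term_val \<nu> t) = clamp m (term_val \<mu> s - term_val \<mu> t)"
    using assms by (auto simp: agree_def)
  from le_iff_clamp[OF this] show ?thesis using assms(3) by simp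
qed

primrec gap_bound :: "int \<Rightarrow> 'v clause \<Rightarrow> bool" where
  "gap_bound m (Gap s t k) \<longleftrightarrow> \<bar>k\<bar> < m"

primrec form_bound :: "int \<Rightarrow> 'v gform \<Rightarrow> bool" where
  "form_bound m GTrue \<longleftrightarrow> True"
| "form_bound m (GClause c) \<longleftrightarrow> gap_bound m c"
| "form_bound m (GNot \<phi>) \<longleftrightarrow> form_bound m \<phi>"
| "form_bound m (GAnd \<phi> \<chi>) \<longleftrightarrow> form_bound m \<phi> \<and> form_bound m \<chi>"

lemma sat_gform_agree:
  assumes "agree X D m \<nu> \<mu>"
  shows "gform_over X D \<phi> \<Longrightarrow> form_bound m \<phi> \<Longrightarrow> sat_gform \<nu> \<phi> \<longleftrightarrow> sat_gform \<mu> \<phi>"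
proof (induction \<phi>)
  case (GClause c)
  then show ?case using sat_clause_agree[OF assms] by (cases c) auto
qed auto

text \<open>One move of an Ehrenfeucht-Fraisse game on the ordered integers. If \<open>a\<close>
  lies within \<open>m\<close> of some \<open>f s\<close>, its offset is copied, and distances known
  up to \<open>2 * m\<close> from \<open>f s\<close> determine those from \<open>a\<close> up to
  \<open>m\<close>. Otherwise \<open>a\<close> is far from every point, and \<open>b\<close> is put
  at distance exactly \<open>m\<close> from the image of a neighbour, the nearest place that still
  counts as far; this keeps \<open>b\<close> small.\<close>

lemma back_and_forth_aux:
  fixes f g :: "'i \<Rightarrow> int" and m :: int
  assumes S: "finite S" and m: "m > 0"
    and eq: "\<And>s t. s \<in> S \<Longrightarrow> t \<in> S \<Longrightarrow> clamp (2 * m) (f s - f t) = clamp (2 * m) (g s - g t)"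
    and A: "\<And>s. s \<in> S \<Longrightarrow> \<bar>g s\<bar> \<le> A" "0 \<le> A"
  obtains b where "\<bar>b\<bar> \<le> A + m" "\<And>s. s \<in> S \<Longrightarrow> clamp m (a - f s) = clamp m (b - g s)"
proof (cases "\<exists>s\<in>S. \<bar>a - f s\<bar> \<le> m")
  case True
  then obtain s where s: "s \<in> S" "\<bar>a - f s\<bar> \<le> m" by auto
  show ?thesis
  proof
    show "\<bar>g s + (a - f s)\<bar> \<le> A + m" using A(1)[of s] s by linarith
    fix t assume "t \<in> S"
    then show "clamp m (a - f t) = clamp m (g s + (a - f s) - g t)"
      using eq[OF s(1), of t] s(2) m unfolding clamp_def by linarith
  qed
next
  case False
  define L U where "L = {s\<in>S. f s \<le> a}" and "U = {s\<in>S. f s > a}"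
  have fin: "finite L" "finite U" and SLU: "S = L \<union> U" using S by (auto simp: L_def U_def)
  consider "L \<noteq> {}" | "L = {}" "U \<noteq> {}" | "S = {}" using SLU by auto
  then show ?thesis
  proof cases
    case 1
    then have "Max (f ` L) \<in> f ` L" using fin(1) by (intro Max_in) auto
    then obtain p where "p \<in> L" "f p = Max (f ` L)" by auto
    then have p: "p \<in> L" "\<forall>t\<in>L. f t \<le> f p" using fin(1) by auto
    have pS: "p \<in> S" "f p \<le> a" using p by (auto simp: L_def)
    show ?thesis
    proof
      show "\<bar>g p + m\<bar> \<le> A + m" using A(1)[OF pS(1)] m by linarith
      fix t assume t: "t \<in> S"
      have h: "\<bar>a - f t\<bar> > m" "\<bar>a - f p\<bar> > m" using False t pS by force+
      show "clamp m (a - f t) = clamp m (g p + m - g t)"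
      proof (cases "f t \<le> a")
        case True
        then have "f t \<le> f p" using p(2) t by (simp add: L_def)
        then have "g t \<le> g p" using le_iff_clamp[OF eq[OF pS(1) t], of 0] m by simp
        then show ?thesis using True h(1) m by (simp add: clamp_ge)
      next
        case False
        \<comment> \<open>The points on both sides of \<open>a\<close> are more than
          \<open>m\<close> away from it, so their images are at least \<open>2 * m\<close> apart,
          and \<open>b\<close> at distance \<open>m\<close> from the lower one is at least
          \<open>m\<close> below the upper one.\<close>
        then have "2 * m \<le> f t - f p" using h pS(2) by linarith
        then have "2 * m \<le> g t - g p" using le_iff_clamp[OF eq[OF t pS(1)], of "2 * m"] m by simp
        then show ?thesis using False h(1) m by (simp add: clamp_le)
      qed
    qed
  next
    case 2
    then have "Min (f ` U) \<in> f ` U" using fin(2) by (intro Min_in) auto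
    then obtain p where "p \<in> U" "f p = Min (f ` U)" by auto
    then have p: "p \<in> U" "\<forall>t\<in>U. f p \<le> f t" using fin(2) by auto
    have pS: "p \<in> S" "f p > a" using p by (auto simp: U_def)
    show ?thesis
    proof
      show "\<bar>g p - m\<bar> \<le> A + m" using A(1)[OF pS(1)] m by linarith
      fix t assume t: "t \<in> S"
      have h: "\<bar>a - f t\<bar> > m" "\<bar>a - f p\<bar> > m" using False t pS by force+
      have "t \<in> U" using t 2(1) SLU by blast
      then have *: "f p \<le> f t" "f t > a" using p(2) unfolding U_def by blast+
      then have "g p \<le> g t" using le_iff_clamp[OF eq[OF t pS(1)], of 0] m by simp
      then show "clamp m (a - f t) = clamp m (g p - m - g t)"
        using * h(1) m by (simp add: clamp_le)
    qed
  next
    case 3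
    show ?thesis by (rule that[of 0]) (use 3 A(2) m in auto)
  qed
qed

lemma finite_terms: "finite X \<Longrightarrow> finite D \<Longrightarrow> finite {s. term_over X D s}"
proof -
  assume "finite X" "finite D"
  moreover have "{s. term_over X D s} \<subseteq> V ` X \<union> K ` D"
  proof
    fix s assume "s \<in> {s. term_over X D s}"
    then show "s \<in> V ` X \<union> K ` D" by (cases s) auto
  qed
  ultimately show ?thesis by (meson finite_UnI finite_imageI finite_subset)
qed

lemma clamp_uminus: "clamp m d = clamp m d' \<Longrightarrow> clamp m (- d) = clamp m (- d')"
  unfolding clamp_def by linarith

lemma agree_insert:
  assumes "agree X D m \<nu> \<mu>"
    and "\<And>s. term_over X D s \<Longrightarrow> clamp m (\<nu> x - term_val \<nu> s) = clamp m (\<mu> x - term_val \<mu> s)"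
  shows "agree (insert x X) D m \<nu> \<mu>"
  unfolding agree_def
proof (intro allI impI)
  fix s t :: "'a gterm"
  assume st: "term_over (insert x X) D s" "term_over (insert x X) D t"
  have h: "term_over X D u \<or> u = V x" if "term_over (insert x X) D u" for u
    using that by (cases u) auto
  have "clamp m (term_val \<nu> u - \<nu> x) = clamp m (term_val \<mu> u - \<mu> x)" if "term_over X D u" for u
    using clamp_uminus[OF assms(2)[OF that]] by simp
  then show "clamp m (term_val \<nu> s - term_val \<nu> t) = clamp m (term_val \<mu> s - term_val \<mu> t)"
    using h[OF st(1)] h[OF st(2)] assms unfolding agree_def by auto
qed

lemma back_and_forth_one:
  assumes "finite X" "finite D" "m > 0" "agree X D (2 * m) \<nu> \<mu>" "x \<notin> X"
    and A: "\<forall>y\<in>X. \<bar>\<mu> y\<bar> \<le> A" "\<forall>c\<in>D. \<bar>c\<bar> \<le> A" "0 \<le> A"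
  obtains b where "\<bar>b\<bar> \<le> A + m" "agree (insert x X) D m \<nu> (\<mu>(x := b))"
proof -
  have "\<bar>term_val \<mu> s\<bar> \<le> A" if "term_over X D s" for s
    using that A by (cases s) auto
  with back_and_forth_aux[OF finite_terms[OF assms(1,2)] assms(3), of "term_val \<nu>" "term_val \<mu>" A "\<nu> x"]
  obtain b where b: "\<bar>b\<bar> \<le> A + m"
    "\<And>s. term_over X D s \<Longrightarrow> clamp m (\<nu> x - term_val \<nu> s) = clamp m (b - term_val \<mu> s)"
    using assms(4) A(3) unfolding agree_def mem_Collect_eq by blast
  have eq: "term_val (\<mu>(x := b)) s = term_val \<mu> s" if "term_over X D s" for s
    using that assms(5) by (cases s) auto
  have "agree X D m \<nu> \<mu>" using agree_mono[OF assms(4)] assms(3) by simp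
  then have "agree X D m \<nu> (\<mu>(x := b))" by (simp add: agree_def eq)
  then have "agree (insert x X) D m \<nu> (\<mu>(x := b))"
    by (rule agree_insert) (simp add: eq b(2))
  with b(1) show ?thesis by (rule that)
qed

text \<open>The variables of \<open>Y\<close> are placed with thresholds
  \<open>2 ^ (card Y - 1) * m\<close> down to \<open>m\<close>. Each placement enlarges the bound on
  the values by its own threshold, and the geometric sum is
  \<open>(2 ^ card Y - 1) * m\<close>.\<close>

lemma back_and_forth:
  assumes "finite Y" "finite X" "finite D" "X \<inter> Y = {}" "m > 0" "agree X D (2 ^ card Y * m) \<nu> \<mu>"
    and A: "\<forall>y\<in>X. \<bar>\<mu> y\<bar> \<le> A" "\<forall>c\<in>D. \<bar>c\<bar> \<le> A" "0 \<le> A"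
  shows "\<exists>\<mu>'. (\<forall>x. x \<notin> Y \<longrightarrow> \<mu>' x = \<mu> x) \<and> agree (X \<union> Y) D m \<nu> \<mu>' \<and>
    (\<forall>y\<in>Y. \<bar>\<mu>' y\<bar> \<le> A + (2 ^ card Y - 1) * m)"
  using assms(1,4,5,6)
proof (induction Y arbitrary: m rule: finite_induct)
  case empty
  then show ?case by auto
next
  case (insert y Y)
  have "agree X D (2 ^ card Y * (2 * m)) \<nu> \<mu>"
    using insert by (simp add: mult_ac)
  with insert.IH[of "2 * m"] insert.prems obtain \<mu>' where \<mu>':
    "\<forall>x. x \<notin> Y \<longrightarrow> \<mu>' x = \<mu> x" "agree (X \<union> Y) D (2 * m) \<nu> \<mu>'"
    "\<forall>y\<in>Y. \<bar>\<mu>' y\<bar> \<le> A + (2 ^ card Y - 1) * (2 * m)"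
    by auto
  define A' where "A' = A + (2 ^ card Y - 1) * (2 * m)"
  have AA': "A \<le> A'" using insert.prems(2) by (simp add: A'_def)
  have X: "\<mu>' x = \<mu> x" if "x \<in> X" for x using \<mu>'(1) insert.prems(1) that by auto
  obtain b where b: "\<bar>b\<bar> \<le> A' + m" "agree (insert y (X \<union> Y)) D m \<nu> (\<mu>'(y := b))"
  proof (rule back_and_forth_one[OF _ assms(3) _ \<mu>'(2), of y A'])
    have "\<bar>\<mu>' x\<bar> \<le> A'" if "x \<in> X" for x
      using bspec[OF A(1) that] AA' X[OF that] by simp
    then show "\<forall>x\<in>X \<union> Y. \<bar>\<mu>' x\<bar> \<le> A'"
      using \<mu>'(3) unfolding A'_def[symmetric] by blast
    show "\<forall>c\<in>D. \<bar>c\<bar> \<le> A'" using A(2) AA' order_trans by blast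
    show "0 \<le> A'" using A(3) AA' by simp
  qed (use insert assms in auto)
  have A'm: "A' + m = A + (2 ^ card (insert y Y) - 1) * m"
    using insert.hyps by (simp add: A'_def algebra_simps)
  have "\<bar>\<mu>' z\<bar> \<le> A' + m" if "z \<in> Y" for z
    using bspec[OF \<mu>'(3) that] insert.prems(2) unfolding A'_def[symmetric] by simp
  then have "\<forall>z\<in>insert y Y. \<bar>(\<mu>'(y := b)) z\<bar> \<le> A' + m"
    using b(1) by simp
  moreover have "\<forall>x. x \<notin> insert y Y \<longrightarrow> (\<mu>'(y := b)) x = \<mu> x" using \<mu>'(1) by simp
  moreover have "agree (X \<union> insert y Y) D m \<nu> (\<mu>'(y := b))" using b(2) by simp
  ultimately show ?case unfolding A'm by blast
qed

text \<open>Over no variables at all the only terms are constants, so any two valuations agree at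
  every threshold. From there all variables of \<open>X\<close> are added by back-and-forth, and
  only the constants contribute to the initial bound \<open>A\<close>.\<close>

lemma small_representative:
  assumes "finite X" "finite D" "m > 0" "\<forall>c\<in>D. \<bar>c\<bar> \<le> A" "0 \<le> A"
  shows "\<exists>\<mu>. agree X D m \<nu> \<mu> \<and> (\<forall>x\<in>X. \<bar>\<mu> x\<bar> \<le> A + (2 ^ card X - 1) * m) \<and> (\<forall>x. x \<notin> X \<longrightarrow> \<mu> x = 0)"
proof -
  have "agree {} D (2 ^ card X * m) \<nu> (\<lambda>_. 0)"
    unfolding agree_def
  proof (intro allI impI)
    fix s t :: "'a gterm" assume "term_over {} D s" "term_over {} D t"
    then show "clamp (2 ^ card X * m) (term_val \<nu> s - term_val \<nu> t) =
      clamp (2 ^ card X * m) (term_val (\<lambda>_. 0) s - term_val (\<lambda>_. 0) t)"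
      by (cases s; cases t) auto
  qed
  from back_and_forth[OF assms(1) _ assms(2) _ assms(3) this _ assms(4,5)] show ?thesis by auto
qed

section \<open>Predecessors under one step\<close>

text \<open>Valuations are arbitrary functions here, without the dummy value outside the variables,
  so that invariance and composition with maps on the integers need no side conditions.
  \<open>reach_iff\<close> and \<open>ef_form_correct\<close> return to \<open>Val\<close> by
  restriction.\<close>

definition moves :: "'v tvar gconstraint set \<Rightarrow> ('v \<Rightarrow> int) \<Rightarrow> ('v \<Rightarrow> int) \<Rightarrow> bool" where
  "moves R \<nu> \<nu>' \<longleftrightarrow> (\<exists>C\<in>R. sat_constraint (oplus \<nu> \<nu>') C)"

definition rules_over :: "'v set \<Rightarrow> int set \<Rightarrow> int \<Rightarrow> 'v tvar gconstraint set \<Rightarrow> bool" where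
  "rules_over X D m R \<longleftrightarrow> (\<forall>C\<in>R. \<forall>c\<in>set C. clause_over (Cur ` X \<union> Nxt ` X) D c \<and> gap_bound m c)"

lemma rules_over_mono: "rules_over X D m R \<Longrightarrow> m \<le> m' \<Longrightarrow> rules_over X D m' R"
proof -
  have "gap_bound m c \<Longrightarrow> m \<le> m' \<Longrightarrow> gap_bound m' c" for c :: "'v tvar clause"
    by (cases c) auto
  then show "rules_over X D m R \<Longrightarrow> m \<le> m' \<Longrightarrow> ?thesis" unfolding rules_over_def by blast
qed

lemma moves_agree:
  assumes "rules_over X D m R" "agree (Cur ` X \<union> Nxt ` X) D m (oplus \<nu> \<nu>') (oplus \<mu> \<mu>')" "moves R \<nu> \<nu>'"
  shows "moves R \<mu> \<mu>'"
proof -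
  have "sat_clause (oplus \<nu> \<nu>') c \<longleftrightarrow> sat_clause (oplus \<mu> \<mu>') c"
    if "clause_over (Cur ` X \<union> Nxt ` X) D c" "gap_bound m c" for c
    using that sat_clause_agree[OF assms(2)] by (cases c) auto
  moreover obtain C where C: "C \<in> R" "sat_constraint (oplus \<nu> \<nu>') C"
    using assms(3) by (auto simp: moves_def)
  moreover have "clause_over (Cur ` X \<union> Nxt ` X) D c \<and> gap_bound m c" if "c \<in> set C" for c
    using assms(1) C(1) that by (simp add: rules_over_def)
  ultimately have "sat_constraint (oplus \<mu> \<mu>') C" by (simp add: sat_constraint_def)
  with C(1) show ?thesis by (auto simp: moves_def)
qed

lemma agree_image:
  assumes "agree Y D m \<nu> \<mu>" "h ` X \<subseteq> Y"
  shows "agree X D m (\<nu> \<circ> h) (\<mu> \<circ> h)"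
  unfolding agree_def
proof (intro allI impI)
  fix s t assume st: "term_over X D s" "term_over X D t"
  have h: "term_over Y D (map_gterm h u) \<and> term_val (\<eta> \<circ> h) u = term_val \<eta> (map_gterm h u)"
    if "term_over X D u" for u \<eta>
    using that assms(2) by (cases u) auto
  show "clamp m (term_val (\<nu> \<circ> h) s - term_val (\<nu> \<circ> h) t) =
    clamp m (term_val (\<mu> \<circ> h) s - term_val (\<mu> \<circ> h) t)"
    using assms(1) st h unfolding agree_def by metis
qed

lemma oplus_comp [simp]: "oplus \<nu> \<nu>' \<circ> Cur = \<nu>" "oplus \<nu> \<nu>' \<circ> Nxt = \<nu>'"
  by (auto simp: oplus_def)

lemma oplus_surj: "\<eta> = oplus (\<eta> \<circ> Cur) (\<eta> \<circ> Nxt)"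
  by (auto simp: oplus_def fun_eq_iff split: tvar.split)

text \<open>A transition is one valuation of the doubled variables. The primed copies are the
  \<open>card X\<close> variables to be added, which explains the factor
  \<open>2 ^ card X\<close>.\<close>

lemma moves_back_and_forth:
  assumes fin: "finite X" "finite D" and m: "m > 0" and R: "rules_over X D m R"
    and agr: "agree X D (2 ^ card X * m) \<nu> \<mu>" and \<nu>': "moves R \<nu> \<nu>'"
    and A: "\<forall>y\<in>X. \<bar>\<mu> y\<bar> \<le> A" "\<forall>c\<in>D. \<bar>c\<bar> \<le> A" "0 \<le> A"
  shows "\<exists>\<mu>'. moves R \<mu> \<mu>' \<and> agree X D m \<nu>' \<mu>' \<and>
    (\<forall>x\<in>X. \<bar>\<mu>' x\<bar> \<le> A + (2 ^ card X - 1) * m) \<and> (\<forall>x. x \<notin> X \<longrightarrow> \<mu>' x = 0)"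
proof -
  have cN: "card (Nxt ` X) = card X" by (rule card_image) (auto simp: inj_on_def)
  have disj: "Cur ` X \<inter> Nxt ` X = {}" by auto
  \<comment> \<open>Only the unprimed part matters before the primed variables are placed. The
    provisional successor 0 remains in force outside \<open>X\<close>.\<close>
  have "agree (Cur ` X) D (2 ^ card (Nxt ` X) * m) (oplus \<nu> \<nu>') (oplus \<mu> (\<lambda>_. 0))"
    unfolding agree_def cN
  proof (intro allI impI)
    fix s t :: "'a tvar gterm"
    assume st: "term_over (Cur ` X) D s" "term_over (Cur ` X) D t"
    have h: "\<exists>u'. term_over X D u' \<and> term_val (oplus \<nu> \<nu>') u = term_val \<nu> u' \<and>
      term_val (oplus \<mu> (\<lambda>_. 0)) u = term_val \<mu> u'" if "term_over (Cur ` X) D u" for u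
    proof (cases u)
      case (V y)
      then obtain x where "y = Cur x" "x \<in> X" using \<open>term_over (Cur ` X) D u\<close> by auto
      then show ?thesis using V by (intro exI[of _ "V x"]) (auto simp: oplus_def)
    next
      case (K c)
      then show ?thesis using that by (intro exI[of _ "K c"]) auto
    qed
    show "clamp (2 ^ card X * m) (term_val (oplus \<nu> \<nu>') s - term_val (oplus \<nu> \<nu>') t) =
      clamp (2 ^ card X * m) (term_val (oplus \<mu> (\<lambda>_. 0)) s - term_val (oplus \<mu> (\<lambda>_. 0)) t)"
      using h[OF st(1)] h[OF st(2)] agr unfolding agree_def by metis
  qed
  from back_and_forth[OF _ _ fin(2) disj m this _ A(2,3)] fin(1) A(1)
  obtain \<eta> where \<eta>: "\<forall>x. x \<notin> Nxt ` X \<longrightarrow> \<eta> x = oplus \<mu> (\<lambda>_. 0) x"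
    "agree (Cur ` X \<union> Nxt ` X) D m (oplus \<nu> \<nu>') \<eta>"
    "\<forall>y\<in>Nxt ` X. \<bar>\<eta> y\<bar> \<le> A + (2 ^ card X - 1) * m"
    unfolding cN by (auto simp: oplus_def)
  have cur: "\<eta> \<circ> Cur = \<mu>" using \<eta>(1) by (auto simp: oplus_def fun_eq_iff)
  define \<mu>' where "\<mu>' = \<eta> \<circ> Nxt"
  have op: "\<eta> = oplus \<mu> \<mu>'" unfolding \<mu>'_def cur[symmetric] by (rule oplus_surj)
  have "moves R \<mu> \<mu>'" using moves_agree[OF R _ \<nu>'] \<eta>(2) op by metis
  moreover have "agree X D m \<nu>' \<mu>'"
    using agree_image[OF \<eta>(2), of Nxt X] by (simp add: \<mu>'_def)
  moreover have "\<forall>x. x \<notin> X \<longrightarrow> \<mu>' x = 0"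
    using \<eta>(1) by (auto simp: \<mu>'_def oplus_def image_iff)
  moreover have "\<forall>x\<in>X. \<bar>\<mu>' x\<bar> \<le> A + (2 ^ card X - 1) * m"
    using \<eta>(3) by (simp add: \<mu>'_def)
  ultimately show ?thesis by blast
qed

definition invariant :: "'v set \<Rightarrow> int set \<Rightarrow> int \<Rightarrow> ('v \<Rightarrow> int) set \<Rightarrow> bool" where
  "invariant X D m A \<longleftrightarrow> (\<forall>\<nu> \<mu>. agree X D m \<nu> \<mu> \<longrightarrow> \<nu> \<in> A \<longrightarrow> \<mu> \<in> A)"

lemma invariant_mono: "invariant X D m A \<Longrightarrow> m \<le> m' \<Longrightarrow> invariant X D m' A"
  unfolding invariant_def using agree_mono by blast

lemma invariant_Un: "invariant X D m A \<Longrightarrow> invariant X D m B \<Longrightarrow> invariant X D m (A \<union> B)"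
  unfolding invariant_def by blast

lemma invariant_sat:
  "gform_over X D \<phi> \<Longrightarrow> form_bound m \<phi> \<Longrightarrow> invariant X D m {\<nu>. sat_gform \<nu> \<phi>}"
  unfolding invariant_def using sat_gform_agree by blast

definition Pre :: "'v tvar gconstraint set \<Rightarrow> ('v \<Rightarrow> int) set \<Rightarrow> ('v \<Rightarrow> int) set" where
  "Pre R A = {\<nu>. \<exists>\<nu>'\<in>A. moves R \<nu> \<nu>'}"

lemma invariant_Pre:
  assumes "finite X" "finite D" "m > 0" "rules_over X D m R" "invariant X D m A"
  shows "invariant X D (2 ^ card X * m) (Pre R A)"
  unfolding invariant_def
proof (intro allI impI)
  fix \<nu> \<mu> assume *: "agree X D (2 ^ card X * m) \<nu> \<mu>" "\<nu> \<in> Pre R A"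
  then obtain \<nu>' where \<nu>': "\<nu>' \<in> A" "moves R \<nu> \<nu>'" by (auto simp: Pre_def)
  define b where "b = Max (insert 0 (abs ` (\<mu> ` X \<union> D)))"
  have b: "\<forall>y\<in>X. \<bar>\<mu> y\<bar> \<le> b" "\<forall>c\<in>D. \<bar>c\<bar> \<le> b" "0 \<le> b"
    using assms(1,2) by (auto simp: b_def)
  from moves_back_and_forth[OF assms(1-4) *(1) \<nu>'(2) b]
  obtain \<mu>' where "moves R \<mu> \<mu>'" "agree X D m \<nu>' \<mu>'" by auto
  moreover from this have "\<mu>' \<in> A" using \<nu>'(1) assms(5) unfolding invariant_def by blast
  ultimately show "\<mu> \<in> Pre R A" by (auto simp: Pre_def)
qed

section \<open>Gap definability of invariant sets\<close>

lemma finite_conjunction: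
  assumes "finite F" "\<forall>P\<in>F. \<exists>\<phi>. gform_over X D \<phi> \<and> {\<nu>. sat_gform \<nu> \<phi>} = P"
  shows "\<exists>\<phi>. gform_over X D \<phi> \<and> {\<nu>. sat_gform \<nu> \<phi>} = \<Inter>F"
  using assms
proof (induction F rule: finite_induct)
  case empty
  show ?case by (rule exI[of _ GTrue]) simp
next
  case (insert P F)
  then obtain \<phi> \<chi> where "gform_over X D \<phi>" "{\<nu>. sat_gform \<nu> \<phi>} = P" "gform_over X D \<chi>"
    "{\<nu>. sat_gform \<nu> \<chi>} = \<Inter>F" by auto
  then show ?case by (intro exI[of _ "GAnd \<phi> \<chi>"]) auto
qed

lemma finite_disjunction:
  assumes "finite F" "\<forall>P\<in>F. \<exists>\<phi>. gform_over X D \<phi> \<and> {\<nu>. sat_gform \<nu> \<phi>} = P"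
  shows "\<exists>\<phi>. gform_over X D \<phi> \<and> {\<nu>. sat_gform \<nu> \<phi>} = \<Union>F"
proof -
  have "\<forall>P\<in>uminus ` F. \<exists>\<phi>. gform_over X D \<phi> \<and> {\<nu>. sat_gform \<nu> \<phi>} = P"
  proof
    fix P assume "P \<in> uminus ` F"
    then obtain \<phi> where "gform_over X D \<phi>" "P = - {\<nu>. sat_gform \<nu> \<phi>}" using assms(2) by auto
    then show "\<exists>\<phi>. gform_over X D \<phi> \<and> {\<nu>. sat_gform \<nu> \<phi>} = P"
      by (intro exI[of _ "GNot \<phi>"]) auto
  qed
  from finite_conjunction[OF _ this] assms(1)
  obtain \<phi> where "gform_over X D \<phi>" "{\<nu>. sat_gform \<nu> \<phi>} = \<Inter>(uminus ` F)" by auto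
  then show ?thesis by (intro exI[of _ "GNot \<phi>"]) auto
qed

text \<open>There are finitely many clauses with gap at most \<open>\<bar>m\<bar>\<close>. The set
  \<open>T \<nu>\<close> of those that hold determines all truncated differences, so an invariant
  set is a finite union of classes of equal \<open>T\<close>, each given by a conjunction of clauses
  and negated clauses.\<close>

lemma invariant_definable:
  assumes "finite X" "finite D" "invariant X D m A"
  shows "\<exists>\<phi>. gform_over X D \<phi> \<and> {\<nu>. sat_gform \<nu> \<phi>} = A"
proof -
  \<comment> \<open>The bound is \<open>\<bar>m\<bar> + 1\<close> because \<open>gap_bound\<close>
    is strict and the gaps \<open>m\<close> and \<open>- m\<close> are needed to recognise
    truncation.\<close>
  define cls where "cls = {c. clause_over X D c \<and> gap_bound (\<bar>m\<bar> + 1) c}"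
  define T where "T \<nu> = {c \<in> cls. sat_clause \<nu> c}" for \<nu>
  have "cls \<subseteq> (\<lambda>(s, t, k). Gap s t k) ` ({s. term_over X D s} \<times> {s. term_over X D s} \<times> {- \<bar>m\<bar>..\<bar>m\<bar>})"
  proof
    fix c assume "c \<in> cls"
    then show "c \<in> (\<lambda>(s, t, k). Gap s t k) ` ({s. term_over X D s} \<times> {s. term_over X D s} \<times> {- \<bar>m\<bar>..\<bar>m\<bar>})"
      by (cases c) (force simp: cls_def)
  qed
  then have fin: "finite cls"
    by (rule finite_subset) (intro finite_imageI finite_cartesian_product finite_terms assms finite_atLeastAtMost_int)
  have agr: "agree X D m \<nu> \<mu>" if "T \<nu> = T \<mu>" for \<nu> \<mu>
    unfolding agree_def
  proof (intro allI impI)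
    fix s t :: "'a gterm" assume st: "term_over X D s" "term_over X D t"
    have *: "k \<le> term_val \<nu> s - term_val \<nu> t \<longleftrightarrow> k \<le> term_val \<mu> s - term_val \<mu> t" if "\<bar>k\<bar> \<le> \<bar>m\<bar>" for k
    proof -
      have "Gap s t k \<in> T \<nu> \<longleftrightarrow> Gap s t k \<in> T \<mu>" using \<open>T \<nu> = T \<mu>\<close> by simp
      then show ?thesis using st that by (auto simp: T_def cls_def)
    qed
    have **: "clamp m d = clamp m d'" if "\<And>k. \<bar>k\<bar> \<le> \<bar>m\<bar> \<Longrightarrow> k \<le> d \<longleftrightarrow> k \<le> d'" for d d'
    proof -
      have "d \<le> \<bar>m\<bar> \<and> - \<bar>m\<bar> \<le> d \<Longrightarrow> d \<le> d'" "d' \<le> \<bar>m\<bar> \<and> - \<bar>m\<bar> \<le> d' \<Longrightarrow> d' \<le> d"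
        "\<bar>m\<bar> \<le> d \<longleftrightarrow> \<bar>m\<bar> \<le> d'" "- \<bar>m\<bar> \<le> d \<longleftrightarrow> - \<bar>m\<bar> \<le> d'"
        using that[of d] that[of d'] that[of "\<bar>m\<bar>"] that[of "- \<bar>m\<bar>"] by auto
      then show ?thesis unfolding clamp_def by linarith
    qed
    show "clamp m (term_val \<nu> s - term_val \<nu> t) = clamp m (term_val \<mu> s - term_val \<mu> t)"
      by (rule **) (rule *)
  qed
  have type_definable: "\<exists>\<phi>. gform_over X D \<phi> \<and> {\<nu>. sat_gform \<nu> \<phi>} = {\<nu>. T \<nu> = Z}" if "Z \<subseteq> cls" for Z
  proof -
    define F where "F = (\<lambda>c. {\<nu>. sat_clause \<nu> c \<longleftrightarrow> c \<in> Z}) ` cls"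
    have "\<forall>P\<in>F. \<exists>\<phi>. gform_over X D \<phi> \<and> {\<nu>. sat_gform \<nu> \<phi>} = P"
    proof
      fix P assume "P \<in> F"
      then obtain c where "c \<in> cls" "P = {\<nu>. sat_clause \<nu> c \<longleftrightarrow> c \<in> Z}" by (auto simp: F_def)
      then show "\<exists>\<phi>. gform_over X D \<phi> \<and> {\<nu>. sat_gform \<nu> \<phi>} = P"
        by (intro exI[of _ "if c \<in> Z then GClause c else GNot (GClause c)"]) (auto simp: cls_def)
    qed
    from finite_conjunction[OF _ this] fin
    have "\<exists>\<phi>. gform_over X D \<phi> \<and> {\<nu>. sat_gform \<nu> \<phi>} = \<Inter>F" by (simp add: F_def)
    moreover have "\<Inter>F = {\<nu>. T \<nu> = Z}"
      using that by (auto simp: F_def T_def)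
    ultimately show ?thesis by simp
  qed
  define F where "F = (\<lambda>Z. {\<nu>. T \<nu> = Z}) ` (T ` A)"
  have sub: "T ` A \<subseteq> Pow cls" by (auto simp: T_def)
  then have "finite F" unfolding F_def using fin by (meson finite_imageI finite_Pow_iff finite_subset)
  moreover have "\<forall>P\<in>F. \<exists>\<phi>. gform_over X D \<phi> \<and> {\<nu>. sat_gform \<nu> \<phi>} = P"
    using type_definable sub by (auto simp: F_def)
  ultimately have "\<exists>\<phi>. gform_over X D \<phi> \<and> {\<nu>. sat_gform \<nu> \<phi>} = \<Union>F" by (rule finite_disjunction)
  moreover have "\<Union>F = A"
  proof
    show "\<Union>F \<subseteq> A"
    proof
      fix \<nu> assume "\<nu> \<in> \<Union>F"
      then obtain \<mu> where "\<mu> \<in> A" "T \<mu> = T \<nu>" by (auto simp: F_def)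
      then show "\<nu> \<in> A" using agr assms(3) unfolding invariant_def by blast
    qed
  qed (auto simp: F_def)
  ultimately show ?thesis by simp
qed

section \<open>Stabilisation of iterated predecessors\<close>

text \<open>Small differences are kept and larger ones may only grow. Negative differences are left
  free, since \<open>stretch_le\<close> also considers the terms in the opposite order.\<close>

definition stretch_rel :: "int \<Rightarrow> int \<Rightarrow> int \<Rightarrow> bool" where
  "stretch_rel B d d' \<longleftrightarrow> (0 \<le> d \<longrightarrow> d \<le> d' \<and> (d \<le> B \<longrightarrow> d' = d))"

text \<open>Infinitely many values are negative, or some value recurs infinitely often, or the
  sequence tends to infinity and has a nondecreasing subsequence of large values.\<close>

lemma stretch_subsequence:
  fixes d :: "nat \<Rightarrow> int"
  shows "\<exists>r :: nat \<Rightarrow> nat. strict_mono r \<and> (\<forall>i j. i < j \<longrightarrow> stretch_rel B (d (r i)) (d (r j)))"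
proof -
  consider "infinite {n. d n < 0}" | x where "infinite {n. d n = x}"
    | "finite {n. d n < 0}" "\<And>x. finite {n. d n = x}" by auto
  then show ?thesis
  proof cases
    case 1
    then have "d (Infinite_Set.enumerate {n. d n < 0} i) < 0" for i using enumerate_in_set by blast
    then have "stretch_rel B (d (Infinite_Set.enumerate {n. d n < 0} i)) y" for i y
      unfolding stretch_rel_def using not_le by blast
    with strict_mono_enumerate[OF 1] show ?thesis by blast
  next
    case (2 x)
    then have "d (Infinite_Set.enumerate {n. d n = x} i) = x" for i using enumerate_in_set by blast
    then have "stretch_rel B (d (Infinite_Set.enumerate {n. d n = x} i))
        (d (Infinite_Set.enumerate {n. d n = x} j))" for i j
      by (simp add: stretch_rel_def)
    with strict_mono_enumerate[OF 2] show ?thesis by blast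
  next
    case 3
    have fin: "finite {n. d n \<le> b}" for b
    proof -
      have "{n. d n \<le> b} \<subseteq> {n. d n < 0} \<union> (\<Union>x\<in>{0..b}. {n. d n = x})" by force
      then show ?thesis by (rule finite_subset) (use 3 in auto)
    qed
    have ex: "\<exists>n>k. b < d n" for b k
    proof -
      have "infinite (- {n. d n \<le> b})" using fin[of b] by (simp add: Compl_eq_Diff_UNIV Diff_infinite_finite)
      then show ?thesis unfolding infinite_nat_iff_unbounded by force
    qed
    \<comment> \<open>Beyond \<open>max B 0\<close> the clause on small differences is vacuous, and
      monotonicity suffices.\<close>
    have "\<exists>r. \<forall>n. max B 0 < d (r n) \<and> (r n < r (Suc n) \<and> d (r n) \<le> d (r (Suc n)))"
    proof (rule dependent_nat_choice)
      show "\<exists>x. max B 0 < d x" using ex by blast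
      fix x assume "max B 0 < d x"
      moreover obtain y where "y > x" "d x < d y" using ex by blast
      ultimately show "\<exists>y. max B 0 < d y \<and> x < y \<and> d x \<le> d y"
        by (intro exI[of _ y] conjI) linarith+
    qed
    then obtain r where r: "\<And>n. max B 0 < d (r n)" "\<And>n. r n < r (Suc n)" "\<And>n. d (r n) \<le> d (r (Suc n))"
      by blast
    have "strict_mono r" using r(2) by (simp add: strict_mono_Suc_iff)
    moreover have "d (r i) \<le> d (r j)" if "i < j" for i j
      using lift_Suc_mono_le[of "\<lambda>n. d (r n)"] r(3) that by (simp add: less_imp_le)
    ultimately show ?thesis
      using r(1) unfolding stretch_rel_def by (smt (verit))
  qed
qed

text \<open>The sequence is thinned out once per index. The relation for earlier indices holds
  between all pairs of positions and so survives further thinning.\<close>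

lemma stretch_subsequences:
  fixes d :: "'i \<Rightarrow> nat \<Rightarrow> int"
  assumes "finite I"
  shows "\<exists>r :: nat \<Rightarrow> nat. strict_mono r \<and> (\<forall>x\<in>I. \<forall>i j. i < j \<longrightarrow> stretch_rel B (d x (r i)) (d x (r j)))"
  using assms
proof (induction I rule: finite_induct)
  case empty
  show ?case by (intro exI[of _ "\<lambda>n. n"]) (auto simp: strict_mono_def)
next
  case (insert y I)
  then obtain r :: "nat \<Rightarrow> nat" where r: "strict_mono r" "\<forall>x\<in>I. \<forall>i j. i < j \<longrightarrow> stretch_rel B (d x (r i)) (d x (r j))"
    by blast
  obtain q :: "nat \<Rightarrow> nat" where q: "strict_mono q" "\<forall>i j. i < j \<longrightarrow> stretch_rel B (d y (r (q i))) (d y (r (q j)))"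
    using stretch_subsequence[of B "\<lambda>n. d y (r n)"] by blast
  have qq: "i < j \<Longrightarrow> q i < q j" for i j using q(1) by (simp add: strict_mono_def)
  have "strict_mono (\<lambda>n. r (q n))" using r(1) qq by (simp add: strict_mono_def)
  moreover have "stretch_rel B (d x (r (q i))) (d x (r (q j)))" if "x \<in> insert y I" "i < j" for x i j
    using that q(2) r(2) qq[of i j] by (cases "x = y") simp_all
  ultimately show ?case by (intro exI[of _ "\<lambda>n. r (q n)"]) simp
qed

definition stretch_le :: "'v set \<Rightarrow> int set \<Rightarrow> int \<Rightarrow> ('v \<Rightarrow> int) \<Rightarrow> ('v \<Rightarrow> int) \<Rightarrow> bool" where
  "stretch_le X D B \<nu> \<mu> \<longleftrightarrow> (\<forall>s t. term_over X D s \<longrightarrow> term_over X D t \<longrightarrow>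
     stretch_rel B (term_val \<nu> s - term_val \<nu> t) (term_val \<mu> s - term_val \<mu> t))"

lemma stretch_le_almost_full:
  fixes \<nu> :: "nat \<Rightarrow> 'v \<Rightarrow> int"
  assumes "finite X" "finite D"
  obtains i j where "i < j" "stretch_le X D B (\<nu> i) (\<nu> j)"
proof -
  let ?I = "{s. term_over X D s} \<times> {s. term_over X D s}"
  have "finite ?I" using finite_terms[OF assms] by simp
  from stretch_subsequences[OF this, of B "\<lambda>(s, t) n. term_val (\<nu> n) s - term_val (\<nu> n) t"]
  obtain r :: "nat \<Rightarrow> nat" where r: "strict_mono r" and
    *: "\<forall>x\<in>?I. \<forall>i j. i < j \<longrightarrow> stretch_rel B ((\<lambda>(s, t) n. term_val (\<nu> n) s - term_val (\<nu> n) t) x (r i))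
      ((\<lambda>(s, t) n. term_val (\<nu> n) s - term_val (\<nu> n) t) x (r j))" by blast
  show ?thesis
  proof
    show "r 0 < r 1" using r by (simp add: strict_mono_def)
    show "stretch_le X D B (\<nu> (r 0)) (\<nu> (r 1))"
      unfolding stretch_le_def
    proof (intro allI impI)
      fix s t :: "'v gterm" assume "term_over X D s" "term_over X D t"
      then show "stretch_rel B (term_val (\<nu> (r 0)) s - term_val (\<nu> (r 0)) t)
        (term_val (\<nu> (r 1)) s - term_val (\<nu> (r 1)) t)"
        using *[rule_format, of "(s, t)" 0 1] by simp
    qed
  qed
qed

text \<open>The shift \<open>h z - z\<close> is that of the last point of \<open>f ` S\<close> up to \<open>top z\<close>, the end of the cluster of \<open>P\<close>
  around \<open>z\<close>; a cluster has length at most \<open>B\<close>, and so contains only points with equal shifts.\<close>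

lemma stretch_extension:
  assumes fin: "finite S" "finite P" and M: "0 \<le> M" "int (card P) * M \<le> B"
    and rel: "\<And>s t. s \<in> S \<Longrightarrow> t \<in> S \<Longrightarrow> stretch_rel B (f s - f t) (g s - g t)"
  shows "\<exists>h :: int \<Rightarrow> int. (\<forall>a b. a \<le> b \<longrightarrow> b - a \<le> h b - h a) \<and> (\<forall>s\<in>S. h (f s) = g s) \<and>
    (\<forall>p\<in>P. \<forall>q\<in>P. \<bar>p - q\<bar> \<le> M \<longrightarrow> h p - h q = p - q)"
proof -
  \<comment> \<open>The integer \<open>i\<close> stands for the unit interval from \<open>i\<close>
    to \<open>i + 1\<close>. A maximal run of bridged integers spans a cluster, that is, points of
    \<open>P\<close> linked by jumps of at most \<open>M\<close>.\<close>
  define bridged where "bridged = {i. \<exists>p\<in>P. \<exists>q\<in>P. p \<le> i \<and> i < q \<and> q - p \<le> M}"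
  have sub: "bridged \<subseteq> (\<Union>p\<in>P. {p..<p + M})" by (auto simp: bridged_def)
  have finb: "finite bridged" by (rule finite_subset[OF sub]) (use fin in auto)
  \<comment> \<open>Each bridged integer lies less than \<open>M\<close> above a point of
    \<open>P\<close>; this is the origin of the bound \<open>card P * M\<close> on the length of a
    cluster.\<close>
  have "card bridged \<le> card (\<Union>p\<in>P. {p..<p + M})" by (rule card_mono[OF _ sub]) (use fin in auto)
  also have "\<dots> \<le> (\<Sum>p\<in>P. card {p..<p + M})" by (rule card_UN_le[OF fin(2)])
  also have "\<dots> = card P * nat M" by simp
  finally have "int (card bridged) \<le> int (card P * nat M)" by (simp only: of_nat_le_iff)
  with M have card: "int (card bridged) \<le> B" by simp
  define top where "top z = z + int (LEAST n. z + int n \<notin> bridged)" for z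
  have ex: "\<exists>n. z + int n \<notin> bridged" for z
  proof (rule ccontr)
    assume "\<not> ?thesis"
    then have "range (\<lambda>n. z + int n) \<subseteq> bridged" by auto
    moreover have "infinite (range (\<lambda>n. z + int n))" by (rule Infinite_Set.range_inj_infinite) (auto simp: inj_on_def)
    ultimately show False using finb finite_subset by blast
  qed
  have top_ge: "z \<le> top z" for z by (simp add: top_def)
  have top_nb: "top z \<notin> bridged" for z unfolding top_def by (rule LeastI_ex[OF ex])
  have top_least: "top z \<le> y" if "z \<le> y" "y \<notin> bridged" for y z
  proof -
    have "(LEAST n. z + int n \<notin> bridged) \<le> nat (y - z)" by (rule Least_le) (use that in simp)
    then show ?thesis using that(1) by (simp add: top_def)
  qed
  have top_mono: "a \<le> b \<Longrightarrow> top a \<le> top b" for a b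
    using top_least top_nb top_ge order_trans by meson
  have top_le: "top z \<le> z + B" for z
  proof -
    have "{z..<top z} \<subseteq> bridged" using top_least by (meson atLeastLessThan_iff not_le subsetI)
    then have "card {z..<top z} \<le> card bridged" by (rule card_mono[OF finb])
    then show ?thesis using card top_ge[of z] by simp
  qed
  have top_P: "top p = top q" if "p \<in> P" "q \<in> P" "p \<le> q" "q - p \<le> M" for p q
  proof -
    have "q \<le> top p"
      using top_nb[of p] top_ge[of p] that unfolding bridged_def by (auto simp: not_less)
    then have "top q \<le> top p" by (rule top_least[OF _ top_nb])
    then show ?thesis using top_mono[OF that(3)] by simp
  qed
  \<comment> \<open>The least prescribed shift serves as default below all prescribed points, where
    the maximum would be over the empty set, and it never exceeds a prescribed shift.\<close>
  define c where "c = (if S = {} then 0 else Min ((\<lambda>s. g s - f s) ` S))"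
  define Sh where "Sh z = insert c ((\<lambda>s. g s - f s) ` {s\<in>S. f s \<le> top z})" for z
  define h where "h z = z + Max (Sh z)" for z
  have finS: "finite (Sh z)" "Sh z \<noteq> {}" for z using fin by (auto simp: Sh_def)
  have c_le: "c \<le> g s - f s" if "s \<in> S" for s using that fin(1) by (auto simp: c_def)
  show ?thesis
  proof (intro exI[of _ h] conjI allI ballI impI)
    fix a b :: int assume "a \<le> b"
    \<comment> \<open>Distances do not decrease exactly if the shift does not.\<close>
    then have "Sh a \<subseteq> Sh b" using top_mono[of a b] by (auto simp: Sh_def)
    then have "Max (Sh a) \<le> Max (Sh b)" using finS by (intro Max_mono) auto
    then show "b - a \<le> h b - h a" by (simp add: h_def)
  next
    fix t assume t: "t \<in> S"
    \<comment> \<open>A point to the left has at most the shift of \<open>t\<close>, as distances do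
      not shrink. A point to the right but below \<open>top (f t)\<close> is at distance at most
      \<open>B\<close>; this distance is kept exactly, so the shifts coincide.\<close>
    have "g s - f s \<le> g t - f t" if s: "s \<in> S" "f s \<le> top (f t)" for s
    proof (cases "f s \<le> f t")
      case True
      then show ?thesis using rel[OF t s(1)] by (simp add: stretch_rel_def)
    next
      case False
      then show ?thesis using rel[OF s(1) t] s(2) top_le[of "f t"] by (simp add: stretch_rel_def)
    qed
    then have "Max (Sh (f t)) = g t - f t"
      by (intro Max_eqI finS) (use t c_le top_ge in \<open>auto simp: Sh_def\<close>)
    then show "h (f t) = g t" by (simp add: h_def)
  next
    fix p q assume "p \<in> P" "q \<in> P" "\<bar>p - q\<bar> \<le> M"
    then have "top p = top q" using top_P[of p q] top_P[of q p] by linarith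
    then show "h p - h q = p - q" by (simp add: h_def Sh_def)
  qed
qed

text \<open>A positive clause forces the value of its second term to be at most that of the first,
  and \<open>h\<close> does not shrink their difference. A negative gap would be an upper bound on a
  distance, which stretching may violate.\<close>

lemma moves_stretch:
  assumes R: "rules_over X D m R" "\<forall>C\<in>R. \<forall>c\<in>set C. positive_clause c"
    and h: "\<And>a b. a \<le> b \<Longrightarrow> b - a \<le> h b - h a" "\<And>c. c \<in> D \<Longrightarrow> h c = c"
    and "moves R \<nu> \<nu>'"
  shows "moves R (h \<circ> \<nu>) (h \<circ> \<nu>')"
proof -
  have tv: "term_val (oplus (h \<circ> \<nu>) (h \<circ> \<nu>')) s = h (term_val (oplus \<nu> \<nu>') s)"
    if "term_over Y D s" for s Y
    using that h(2) by (cases s) (auto simp: oplus_def split: tvar.split)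
  have "sat_clause (oplus (h \<circ> \<nu>) (h \<circ> \<nu>')) c"
    if c: "clause_over Y D c" "positive_clause c" "sat_clause (oplus \<nu> \<nu>') c" for c Y
  proof (cases c)
    case (Gap s t k)
    then show ?thesis
      using c h(1)[of "term_val (oplus \<nu> \<nu>') t" "term_val (oplus \<nu> \<nu>') s"] tv[of Y s] tv[of Y t]
      by simp
  qed
  moreover obtain C where C: "C \<in> R" "sat_constraint (oplus \<nu> \<nu>') C"
    using assms(5) by (auto simp: moves_def)
  moreover have "clause_over (Cur ` X \<union> Nxt ` X) D c \<and> positive_clause c" if "c \<in> set C" for c
    using R C(1) that by (simp add: rules_over_def)
  ultimately have "sat_constraint (oplus (h \<circ> \<nu>) (h \<circ> \<nu>')) C"
    unfolding sat_constraint_def by blast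
  with C(1) show ?thesis by (auto simp: moves_def)
qed

lemma moves_power_stretch:
  assumes R: "rules_over X D m R" "\<forall>C\<in>R. \<forall>c\<in>set C. positive_clause c"
    and h: "\<And>a b. a \<le> b \<Longrightarrow> b - a \<le> h b - h a" "\<And>c. c \<in> D \<Longrightarrow> h c = c"
  shows "(moves R ^^ k) \<nu> \<kappa> \<Longrightarrow> (moves R ^^ k) (h \<circ> \<nu>) (h \<circ> \<kappa>)"
proof (induction k arbitrary: \<kappa>)
  case (Suc k)
  then obtain \<rho> where "(moves R ^^ k) \<nu> \<rho>" "moves R \<rho> \<kappa>" by auto
  with Suc.IH have "(moves R ^^ k) (h \<circ> \<nu>) (h \<circ> \<rho>)" "moves R (h \<circ> \<rho>) (h \<circ> \<kappa>)"
    using moves_stretch[OF R h, of \<rho> \<kappa>] by blast+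
  then show ?case unfolding relpowp.simps by - (rule relcomppI)
qed simp

section \<open>Iterated predecessors\<close>

text \<open>The target \<open>A\<close> itself is added at each stage, so that every stage has the
  form \<open>A \<union> Pre R B\<close> that \<open>pre_check\<close> is able to test.\<close>

primrec Pre_upto :: "'v tvar gconstraint set \<Rightarrow> ('v \<Rightarrow> int) set \<Rightarrow> nat \<Rightarrow> ('v \<Rightarrow> int) set" where
  "Pre_upto R A 0 = A"
| "Pre_upto R A (Suc n) = A \<union> Pre R (Pre_upto R A n)"

lemma Pre_upto_iff: "\<nu> \<in> Pre_upto R A n \<longleftrightarrow> (\<exists>k\<le>n. \<exists>\<kappa>\<in>A. (moves R ^^ k) \<nu> \<kappa>)"
proof (induction n arbitrary: \<nu>)
  case (Suc n)
  show ?case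
  proof
    assume "\<nu> \<in> Pre_upto R A (Suc n)"
    then consider "\<nu> \<in> A" | \<nu>' k \<kappa> where "moves R \<nu> \<nu>'" "k \<le> n" "\<kappa> \<in> A" "(moves R ^^ k) \<nu>' \<kappa>"
      using Suc by (auto simp: Pre_def)
    then show "\<exists>k\<le>Suc n. \<exists>\<kappa>\<in>A. (moves R ^^ k) \<nu> \<kappa>"
    proof cases
      case 1
      then show ?thesis by (intro exI[of _ 0]) auto
    next
      case 2
      then have "(moves R ^^ Suc k) \<nu> \<kappa>" by (intro relpowp_Suc_I2)
      then show ?thesis using 2 by (intro exI[of _ "Suc k"]) auto
    qed
  next
    assume "\<exists>k\<le>Suc n. \<exists>\<kappa>\<in>A. (moves R ^^ k) \<nu> \<kappa>"
    then obtain k \<kappa> where k: "k \<le> Suc n" "\<kappa> \<in> A" "(moves R ^^ k) \<nu> \<kappa>" by auto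
    show "\<nu> \<in> Pre_upto R A (Suc n)"
    proof (cases k)
      case (Suc l)
      then obtain \<nu>' where "moves R \<nu> \<nu>'" "(moves R ^^ l) \<nu>' \<kappa>" using k(3) by (metis relpowp_Suc_D2)
      then show ?thesis using k Suc Suc.IH by (auto simp: Pre_def)
    qed (use k in auto)
  qed
qed auto

lemma invariant_Pre_upto:
  assumes "finite X" "finite D" "m > 0" "rules_over X D m R" "invariant X D m A"
  shows "\<exists>l\<ge>m. invariant X D l (Pre_upto R A n)"
proof (induction n)
  case (Suc n)
  then obtain l where l: "l \<ge> m" "invariant X D l (Pre_upto R A n)" by auto
  have "invariant X D (2 ^ card X * l) (Pre R (Pre_upto R A n))"
    using l assms rules_over_mono[OF assms(4) l(1)] by (intro invariant_Pre) auto
  moreover have ll: "l \<le> 2 ^ card X * l" using l(1) assms(3) by simp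
  then have "invariant X D (2 ^ card X * l) A" using l(1) by (intro invariant_mono[OF assms(5)]) linarith
  ultimately show ?case using invariant_Un ll l(1) by (intro exI[of _ "2 ^ card X * l"]) auto
qed (use assms in auto)

text \<open>The bound \<open>B\<close> does not depend on \<open>n\<close>: one map \<open>h\<close>
  transports the whole run, and its rigidity concerns only the values of terms in the last valuation
  \<open>\<kappa>\<close>. There are at most as many such values as terms, so their clusters have
  length at most \<open>B\<close>.\<close>

lemma Pre_upto_stretch:
  assumes fin: "finite X" "finite D" and m: "m > 0" and R: "rules_over X D m R" "\<forall>C\<in>R. \<forall>c\<in>set C. positive_clause c"
    and A: "invariant X D m A" and B: "int (card {s. term_over X D s}) * m \<le> B"
    and le: "stretch_le X D B \<nu> \<mu>" and \<nu>: "\<nu> \<in> Pre_upto R A n"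
  shows "\<mu> \<in> Pre_upto R A n"
proof -
  obtain k \<kappa> where k: "k \<le> n" "\<kappa> \<in> A" "(moves R ^^ k) \<nu> \<kappa>" using \<nu> by (auto simp: Pre_upto_iff)
  let ?S = "{s. term_over X D s}"
  note finS = finite_terms[OF fin]
  have "card (term_val \<kappa> ` ?S) \<le> card ?S" using finS by (rule card_image_le)
  then have "int (card (term_val \<kappa> ` ?S)) * m \<le> int (card ?S) * m" using m by simp
  then have B': "int (card (term_val \<kappa> ` ?S)) * m \<le> B" using B by linarith
  have rel: "s \<in> ?S \<Longrightarrow> t \<in> ?S \<Longrightarrow>
    stretch_rel B (term_val \<nu> s - term_val \<nu> t) (term_val \<mu> s - term_val \<mu> t)" for s t
    using le by (auto simp: stretch_le_def)
  from stretch_extension[where f = "term_val \<nu>" and g = "term_val \<mu>",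
      OF finS finite_imageI[OF finS] less_imp_le[OF m] B' rel]
  obtain h where *: "(\<forall>a b. a \<le> b \<longrightarrow> b - a \<le> h b - h a) \<and>
    (\<forall>s\<in>?S. h (term_val \<nu> s) = term_val \<mu> s) \<and>
    (\<forall>p\<in>term_val \<kappa> ` ?S. \<forall>q\<in>term_val \<kappa> ` ?S. \<bar>p - q\<bar> \<le> m \<longrightarrow> h p - h q = p - q)" ..
  have h: "\<And>a b. a \<le> b \<Longrightarrow> b - a \<le> h b - h a"
    "\<And>s. term_over X D s \<Longrightarrow> h (term_val \<nu> s) = term_val \<mu> s"
    "\<And>s t. term_over X D s \<Longrightarrow> term_over X D t \<Longrightarrow> \<bar>term_val \<kappa> s - term_val \<kappa> t\<bar> \<le> m \<Longrightarrow>
      h (term_val \<kappa> s) - h (term_val \<kappa> t) = term_val \<kappa> s - term_val \<kappa> t"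
    using * by simp_all
  have hD: "h c = c" if "c \<in> D" for c using h(2)[of "K c"] that by simp
  have hX: "h (\<nu> x) = \<mu> x" if "x \<in> X" for x using h(2)[of "V x"] that by simp
  \<comment> \<open>Differences up to \<open>m\<close> are kept exactly, and larger ones do not
    shrink, so their truncations are unchanged too.\<close>
  have "agree X D m \<kappa> (h \<circ> \<kappa>)"
    unfolding agree_def
  proof (intro allI impI)
    fix s t :: "'a gterm" assume st: "term_over X D s" "term_over X D t"
    have tv: "term_val (h \<circ> \<kappa>) u = h (term_val \<kappa> u)" if "term_over X D u" for u
      using that hD by (cases u) auto
    show "clamp m (term_val \<kappa> s - term_val \<kappa> t) = clamp m (term_val (h \<circ> \<kappa>) s - term_val (h \<circ> \<kappa>) t)"
      using h(1)[of "term_val \<kappa> s" "term_val \<kappa> t"] h(1)[of "term_val \<kappa> t" "term_val \<kappa> s"] h(3)[OF st]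
      unfolding tv[OF st(1)] tv[OF st(2)] clamp_def by linarith
  qed
  then have "h \<circ> \<kappa> \<in> A" using A k(2) unfolding invariant_def by blast
  moreover have "(moves R ^^ k) (h \<circ> \<nu>) (h \<circ> \<kappa>)"
    using moves_power_stretch[OF R h(1) hD k(3)] by blast
  ultimately have "h \<circ> \<nu> \<in> Pre_upto R A n" using k(1) by (auto simp: Pre_upto_iff)
  \<comment> \<open>The image \<open>h \<circ> \<nu>\<close> coincides with \<open>\<mu>\<close> on
    \<open>X\<close> only. Invariance at any threshold suffices to disregard the other
    arguments.\<close>
  moreover obtain l where "invariant X D l (Pre_upto R A n)"
    using invariant_Pre_upto[OF fin m R(1) A] by blast
  moreover have "agree X D l (h \<circ> \<nu>) \<mu>" by (rule agree_cong) (simp add: hX)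
  ultimately show ?thesis unfolding invariant_def by blast
qed

lemma Pre_upto_mono: "i \<le> j \<Longrightarrow> Pre_upto R A i \<subseteq> Pre_upto R A j"
  by (auto simp: Pre_upto_iff) (meson order_trans)

text \<open>Otherwise some \<open>\<nu> n\<close> is new at each stage \<open>Suc n\<close>. If
  \<open>\<nu> i\<close> stretches to \<open>\<nu> j\<close> with \<open>i < j\<close>, then
  \<open>\<nu> j\<close> already belongs to stage \<open>j\<close>, which contains stage
  \<open>Suc i\<close>: a contradiction.\<close>

lemma Pre_upto_stabilises:
  assumes "finite X" "finite D" "m > 0" "rules_over X D m R" "\<forall>C\<in>R. \<forall>c\<in>set C. positive_clause c"
    "invariant X D m A"
  shows "\<exists>n. Pre_upto R A (Suc n) = Pre_upto R A n"
proof (rule ccontr)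
  assume "\<not> ?thesis"
  then have "\<forall>n. \<exists>\<nu>. \<nu> \<in> Pre_upto R A (Suc n) - Pre_upto R A n"
    using Pre_upto_mono[of _ "Suc _" R A] by (metis Diff_eq_empty_iff ex_in_conv le_Suc_eq order_refl subset_antisym)
  then obtain \<nu> where \<nu>: "\<And>n. \<nu> n \<in> Pre_upto R A (Suc n)" "\<And>n. \<nu> n \<notin> Pre_upto R A n"
    by (metis DiffD1 DiffD2)
  define B where "B = int (card {s :: 'a gterm. term_over X D s}) * m"
  obtain i j where ij: "i < j" "stretch_le X D B (\<nu> i) (\<nu> j)"
    using stretch_le_almost_full[OF assms(1,2)] by blast
  have "\<nu> i \<in> Pre_upto R A j" using \<nu>(1)[of i] Pre_upto_mono[of "Suc i" j R A] ij(1) by auto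
  then have "\<nu> j \<in> Pre_upto R A j"
    using Pre_upto_stretch[OF assms _ ij(2)] by (simp add: B_def)
  with \<nu>(2) show False by blast
qed

lemma Pre_upto_fixpoint:
  assumes "A \<union> Pre R (Pre_upto R A n) = Pre_upto R A n"
  shows "\<nu> \<in> Pre_upto R A n \<longleftrightarrow> (\<exists>\<kappa>\<in>A. (moves R)\<^sup>*\<^sup>* \<nu> \<kappa>)"
proof
  show "\<nu> \<in> Pre_upto R A n \<Longrightarrow> \<exists>\<kappa>\<in>A. (moves R)\<^sup>*\<^sup>* \<nu> \<kappa>"
    by (auto simp: Pre_upto_iff rtranclp_power)
  assume "\<exists>\<kappa>\<in>A. (moves R)\<^sup>*\<^sup>* \<nu> \<kappa>"
  then obtain \<kappa> where "(moves R)\<^sup>*\<^sup>* \<nu> \<kappa>" "\<kappa> \<in> A" by auto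
  then show "\<nu> \<in> Pre_upto R A n"
  proof (induction rule: converse_rtranclp_induct)
    case base
    then show ?case using assms by blast
  next
    case (step \<nu> \<nu>')
    then have "\<nu> \<in> Pre R (Pre_upto R A n)" by (auto simp: Pre_def)
    then show ?case using assms by blast
  qed
qed

section \<open>Computing on codes\<close>

text \<open>The parity of a \<open>sum_encode\<close> value is its tag. The decoder \<open>d\<close>
  of variables is a parameter, so that plain and transitional clauses share one decoder.\<close>

definition dec_term :: "(nat \<Rightarrow> 'v) \<Rightarrow> nat \<Rightarrow> 'v gterm" where
  "dec_term d n = (if even n then V (d (n div 2)) else K (int_decode (n div 2)))"

definition dec_clause :: "(nat \<Rightarrow> 'v) \<Rightarrow> nat \<Rightarrow> 'v clause" where
  "dec_clause d n = Gap (dec_term d (p1 n)) (dec_term d (p1 (p2 n))) (int_decode (p2 (p2 n)))"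

definition dec_tvar :: "nat \<Rightarrow> nat tvar" where
  "dec_tvar n = (if even n then Cur (n div 2) else Nxt (n div 2))"

lemma dec_term_code: "(\<And>x. d (e x) = x) \<Longrightarrow> dec_term d (term_code e s) = s"
  by (cases s) (simp_all add: dec_term_def sum_encode_def)

lemma dec_clause_code: "(\<And>x. d (e x) = x) \<Longrightarrow> dec_clause d (clause_code e c) = c"
  by (cases c) (simp add: dec_clause_def dec_term_code)

lemma dec_tvar_code: "dec_tvar (tvar_code x) = x"
  by (cases x) (simp_all add: dec_tvar_def sum_encode_def)

text \<open>Every number codes a clause, so the validity of a clause only concerns which variables
  and constants occur.\<close>

lemma code_dec_clause: "clause_code id (dec_clause id n) = n"
proof -
  have "term_code id (dec_term id k) = k" for k
    by (simp add: dec_term_def sum_encode_def)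
  then show ?thesis by (simp add: dec_clause_def)
qed

function dec_form :: "nat \<Rightarrow> nat gform" where
  "dec_form n =
    (if p1 n = 1 then GClause (dec_clause id (p2 n))
     else if p1 n = 2 then GNot (dec_form (p2 n))
     else if p1 n = 3 then GAnd (dec_form (p1 (p2 n))) (dec_form (p2 (p2 n)))
     else GTrue)"
  by pat_completeness auto

lemma p12_less: "p1 n \<noteq> 0 \<Longrightarrow> p1 (p2 n) < n"
  using p1_le[of "p2 n"] p2_less[of n] by simp

lemma p22_less: "p1 n \<noteq> 0 \<Longrightarrow> p2 (p2 n) < n"
  using p2_le[of "p2 n"] p2_less[of n] by simp

termination
  by (relation "measure id") (simp_all add: p2_less p12_less p22_less)

declare dec_form.simps [simp del]

lemma dec_form_code [simp]: "dec_form (gform_code \<phi>) = \<phi>"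
  by (induction \<phi>) (subst dec_form.simps, simp add: dec_clause_code)+

lemma decidable_sat_clause:
  assumes "int_recursive (\<lambda>m. W (p1 m) (d (p2 m)))"
  shows "decidable (\<lambda>m. sat_clause (W (p1 m)) (dec_clause d (p2 m)))"
proof -
  have *: "term_val \<rho> (dec_term d n) = (if even n then \<rho> (d (n div 2)) else int_decode (n div 2))" for \<rho> n
    by (simp add: dec_term_def)
  note W = int_recursive_compose2[of "\<lambda>p x. W p (d x)", OF assms]
  show ?thesis
    unfolding dec_clause_def sat_clause.simps * by (intro tr_intros W)
qed

lemma decidable_sat_gform:
  assumes "int_recursive (\<lambda>m. W (p1 m) (p2 m))"
  shows "decidable (\<lambda>m. sat_gform (W (p1 m)) (dec_form (p2 m)))"
proof -
  have cl: "decidable (\<lambda>m. sat_clause (W (p1 m)) (dec_clause id (p2 m)))"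
    using decidable_sat_clause[of W id] assms by simp
  define F where "F p n h = (of_bool (p1 n = 1 \<and> sat_clause (W p) (dec_clause id (p2 n)) \<or>
      p1 n = 2 \<and> h (p2 n) = 0 \<or> p1 n = 3 \<and> h (p1 (p2 n)) = 1 \<and> h (p2 (p2 n)) = 1 \<or>
      p1 n \<noteq> 1 \<and> p1 n \<noteq> 2 \<and> p1 n \<noteq> 3) :: nat)" for p n and h :: "nat \<Rightarrow> nat"
  have "tr (\<lambda>m. of_bool (sat_gform (W (p1 m)) (dec_form (p2 m))))"
  proof (rule tr_course_of_values)
    show "of_bool (sat_gform (W p) (dec_form n)) = F p n (\<lambda>n. of_bool (sat_gform (W p) (dec_form n)))" for p n
      by (subst dec_form.simps) (simp add: F_def)
    show "F p n h = F p n h'" if "\<And>i. i < n \<Longrightarrow> h i = h' i" for p n h h'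
      using that[OF p2_less[of n]] that[OF p12_less[of n]] that[OF p22_less[of n]]
      by (cases "p1 n = 0") (simp_all add: F_def)
    show "tr (\<lambda>m. F (p1 m) (p1 (p2 m)) (\<lambda>i. lnth (p2 (p2 m)) (p1 (p2 m) - Suc i)))"
      unfolding F_def
      by (intro tr_intros decidable_compose2[of "\<lambda>p n. sat_clause (W p) (dec_clause id n)", OF cl])
  qed
  then show ?thesis by (simp add: decidable_def)
qed

definition list_val :: "nat \<Rightarrow> nat \<Rightarrow> int" where
  "list_val w x = int_decode (lnth w x)"

text \<open>The input valuation is an association list, unlike the positional lists of
  \<open>list_val\<close> used in searches. For a variable without an entry every \<open>y\<close>
  qualifies, so the search ends with 0.\<close>

definition lookup :: "nat \<Rightarrow> nat \<Rightarrow> nat" where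
  "lookup v x = (LEAST y. (\<exists>r\<in>elems v. p1 r = x \<and> p2 r = y) \<or> (\<forall>r\<in>elems v. p1 r \<noteq> x))"

lemma tr_lookup: "tr (\<lambda>m. lookup (p1 m) (p2 m))"
  unfolding lookup_def
proof (rule tr_Least)
  show "\<exists>k. (\<exists>r\<in>elems (p1 n). p1 r = p2 n \<and> p2 r = k) \<or> (\<forall>r\<in>elems (p1 n). p1 r \<noteq> p2 n)" for n
    by blast
qed (intro tr_intros)

lemma lookup_code:
  assumes "codes_val v X \<nu>" "x \<in> X"
  shows "int_decode (lookup v x) = \<nu> x"
proof -
  obtain xs where xs: "set xs = X" "v = list_encode (map (\<lambda>x. prod_encode (x, int_encode (\<nu> x))) xs)"
    using assms(1) by (auto simp: codes_val_def)
  have "elems v = (\<lambda>x. prod_encode (x, int_encode (\<nu> x))) ` X" by (simp add: xs)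
  then have eq: "(\<lambda>y. (\<exists>r\<in>elems v. p1 r = x \<and> p2 r = y) \<or> (\<forall>r\<in>elems v. p1 r \<noteq> x)) = (\<lambda>y. y = int_encode (\<nu> x))"
    using assms(2) by auto
  have "(LEAST y. y = int_encode (\<nu> x)) = int_encode (\<nu> x)" by (rule Least_equality) simp_all
  then show ?thesis unfolding lookup_def eq by simp
qed

lemma decidable_sat_list_val [tr_intros]:
  "tr f \<Longrightarrow> tr g \<Longrightarrow> decidable (\<lambda>n. sat_gform (list_val (f n)) (dec_form (g n)))"
  by (rule decidable_compose2[OF decidable_sat_gform[of list_val]]) (unfold list_val_def, intro tr_intros)

lemma decidable_sat_lookup:
  "decidable (\<lambda>m. sat_gform (\<lambda>x. int_decode (lookup (p1 m) x)) (dec_form (p2 m)))"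
  by (rule decidable_sat_gform) (intro tr_intros tr_lookup)

abbreviation gvars :: "nat \<Rightarrow> nat set" where "gvars g \<equiv> elems (p1 g)"
abbreviation gconsts :: "nat \<Rightarrow> int set" where "gconsts g \<equiv> int_decode ` elems (p1 (p2 g))"
abbreviation grules :: "nat \<Rightarrow> nat" where "grules g \<equiv> p2 (p2 (p2 g))"

text \<open>The number \<open>0\<close> selects all rules, and \<open>Suc a\<close> those labelled with \<open>a\<close>.\<close>

definition rules_of :: "nat \<Rightarrow> nat \<Rightarrow> nat tvar gconstraint set" where
  "rules_of g al = (\<lambda>r. map (dec_clause dec_tvar) (list_decode (p1 r))) `
     {r \<in> elems (grules g). al = 0 \<or> al = Suc (p2 r)}"

lemma moves_rules_of: "moves (rules_of g al) \<nu> \<nu>' \<longleftrightarrow> (\<exists>r\<in>elems (grules g). (al = 0 \<or> al = Suc (p2 r)) \<and>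
    (\<forall>c\<in>elems (p1 r). sat_clause (oplus \<nu> \<nu>') (dec_clause dec_tvar c)))"
  by (auto simp: moves_def rules_of_def sat_constraint_def)

lemma oplus_dec_tvar: "oplus \<nu> \<nu>' (dec_tvar y) = (if even y then \<nu> (y div 2) else \<nu>' (y div 2))"
  by (simp add: oplus_def dec_tvar_def)

lemma decidable_moves_base:
  "decidable (\<lambda>m. moves (rules_of (p1 m) (p1 (p2 m))) (list_val (p1 (p2 (p2 m)))) (list_val (p2 (p2 (p2 m)))))"
proof -
  have "int_recursive (\<lambda>m. oplus (list_val (p1 (p1 m))) (list_val (p2 (p1 m))) (dec_tvar (p2 m)))"
    unfolding oplus_dec_tvar list_val_def by (intro tr_intros)
  from decidable_sat_clause[of "\<lambda>p. oplus (list_val (p1 p)) (list_val (p2 p))", OF this]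
  have base: "decidable (\<lambda>m. sat_clause (oplus (list_val (p1 (p1 m))) (list_val (p2 (p1 m)))) (dec_clause dec_tvar (p2 m)))" .
  have sat: "decidable (\<lambda>n. sat_clause (oplus (list_val (f n)) (list_val (g n))) (dec_clause dec_tvar (h n)))"
    if "tr f" "tr g" "tr h" for f g h
    using decidable_compose[OF base tr_pair[OF tr_pair[OF that(1,2)] that(3)]] by simp
  show ?thesis
    unfolding moves_rules_of by (intro tr_intros sat)
qed

lemma decidable_moves [tr_intros]:
  "tr f \<Longrightarrow> tr g \<Longrightarrow> tr h \<Longrightarrow> tr k \<Longrightarrow>
    decidable (\<lambda>n. moves (rules_of (f n) (g n)) (list_val (h n)) (list_val (k n)))"
  using decidable_compose[OF decidable_moves_base, of "\<lambda>n. prod_encode (f n, prod_encode (g n, prod_encode (h n, k n)))"]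
  by (simp add: tr_pair)

section \<open>Validity of codes\<close>

lemma int_decode_image_iff: "int_decode k \<in> int_decode ` A \<longleftrightarrow> k \<in> A"
  by (auto simp: inj_image_mem_iff[OF inj_int_decode])

definition term_ok :: "nat \<Rightarrow> nat \<Rightarrow> bool" where
  "term_ok g n \<longleftrightarrow> (even n \<and> n div 2 \<in> gvars g) \<or> (odd n \<and> n div 2 \<in> elems (p1 (p2 g)))"

lemma term_over_dec: "term_over (gvars g) (gconsts g) (dec_term id n) \<longleftrightarrow> term_ok g n"
  by (simp add: dec_term_def term_ok_def int_decode_image_iff)

definition tterm_ok :: "nat \<Rightarrow> nat \<Rightarrow> bool" where
  "tterm_ok g n \<longleftrightarrow> (even n \<and> n div 2 div 2 \<in> gvars g) \<or> (odd n \<and> n div 2 \<in> elems (p1 (p2 g)))"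

lemma tterm_over_dec:
  "term_over (Cur ` gvars g \<union> Nxt ` gvars g) (gconsts g) (dec_term dec_tvar n) \<longleftrightarrow> tterm_ok g n"
  by (auto simp: dec_term_def tterm_ok_def int_decode_image_iff dec_tvar_def)

text \<open>Nonnegative integers are those with even codes, so \<open>even\<close> is the test for
  positivity of a gap.\<close>

definition sys_ok :: "nat \<Rightarrow> bool" where
  "sys_ok g \<longleftrightarrow> (\<forall>r\<in>elems (grules g). \<forall>c\<in>elems (p1 r).
     tterm_ok g (p1 c) \<and> tterm_ok g (p1 (p2 c)) \<and> even (p2 (p2 c)))"

lemma sys_ok_iff: "sys_ok g \<longleftrightarrow> (\<forall>C\<in>rules_of g 0. \<forall>c\<in>set C.
    clause_over (Cur ` gvars g \<union> Nxt ` gvars g) (gconsts g) c \<and> positive_clause c)"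
proof -
  have "0 \<le> int_decode k \<longleftrightarrow> even k" for k
    by (simp add: int_decode_def sum_decode_def)
  then show ?thesis
    by (simp add: sys_ok_def rules_of_def dec_clause_def tterm_over_dec)
qed

lemma decidable_sys_ok [tr_intros]:
  assumes "tr f" shows "decidable (\<lambda>n. sys_ok (f n))"
proof -
  have "decidable sys_ok" unfolding sys_ok_def tterm_ok_def by (intro tr_intros)
  then show ?thesis using assms by (rule decidable_compose)
qed

definition form_ok :: "nat \<Rightarrow> nat \<Rightarrow> bool" where
  "form_ok g n \<longleftrightarrow> (\<exists>\<phi>. n = gform_code \<phi> \<and> gform_over (gvars g) (gconsts g) \<phi>)"

text \<open>This is the recursion along codes that makes validity decidable. \<open>dec_form\<close>
  also accepts numbers that code no formula, such as tag 0 with a nonzero payload, but a computed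
  formula must be a genuine \<open>gform_code\<close>.\<close>

lemma form_ok_iff: "form_ok g n \<longleftrightarrow> p1 n = 0 \<and> p2 n = 0 \<or>
    p1 n = 1 \<and> term_ok g (p1 (p2 n)) \<and> term_ok g (p1 (p2 (p2 n))) \<or>
    p1 n = 2 \<and> form_ok g (p2 n) \<or>
    p1 n = 3 \<and> form_ok g (p1 (p2 n)) \<and> form_ok g (p2 (p2 n))" (is "_ \<longleftrightarrow> ?R n")
proof
  assume "form_ok g n"
  then obtain \<phi> where \<phi>: "n = gform_code \<phi>" "gform_over (gvars g) (gconsts g) \<phi>"
    unfolding form_ok_def by blast
  show "?R n"
  proof (cases \<phi>)
    case (GClause c)
    have "clause_over (gvars g) (gconsts g) (dec_clause id (p2 n))"
      using \<phi> GClause by (simp add: dec_clause_code)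
    then show ?thesis using \<phi>(1) GClause by (simp add: dec_clause_def term_over_dec)
  next
    case GTrue
    then show ?thesis using \<phi> by simp
  next
    case (GNot \<chi>)
    then show ?thesis using \<phi> by (auto simp: form_ok_def)
  next
    case (GAnd \<chi> \<chi>')
    then show ?thesis using \<phi> by (auto simp: form_ok_def)
  qed
next
  have n: "n = prod_encode (p1 n, p2 n)" by simp
  assume "?R n"
  then show "form_ok g n"
  proof (elim disjE conjE)
    assume *: "p1 n = 0" "p2 n = 0"
    have "n = gform_code GTrue" by (subst n) (simp only: * gform_code.simps)
    then show ?thesis unfolding form_ok_def by (intro exI[of _ GTrue]) simp
  next
    assume *: "p1 n = 1" "term_ok g (p1 (p2 n))" "term_ok g (p1 (p2 (p2 n)))"
    have "n = gform_code (GClause (dec_clause id (p2 n)))"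
      by (subst n) (simp only: * gform_code.simps code_dec_clause)
    moreover have "gform_over (gvars g) (gconsts g) (GClause (dec_clause id (p2 n)))"
      using * by (simp add: dec_clause_def term_over_dec)
    ultimately show ?thesis unfolding form_ok_def by blast
  next
    assume *: "p1 n = 2" "form_ok g (p2 n)"
    then obtain \<phi> where \<phi>: "p2 n = gform_code \<phi>" "gform_over (gvars g) (gconsts g) \<phi>"
      unfolding form_ok_def by blast
    have "n = gform_code (GNot \<phi>)" by (subst n) (simp only: * \<phi>(1) gform_code.simps)
    then show ?thesis unfolding form_ok_def using \<phi>(2) by (intro exI[of _ "GNot \<phi>"]) simp
  next
    assume *: "p1 n = 3" "form_ok g (p1 (p2 n))" "form_ok g (p2 (p2 n))"
    then obtain \<phi> \<chi> where \<phi>: "p1 (p2 n) = gform_code \<phi>" "gform_over (gvars g) (gconsts g) \<phi>"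
      and \<chi>: "p2 (p2 n) = gform_code \<chi>" "gform_over (gvars g) (gconsts g) \<chi>"
      unfolding form_ok_def by blast
    have "p2 n = prod_encode (gform_code \<phi>, gform_code \<chi>)"
      unfolding \<phi>(1)[symmetric] \<chi>(1)[symmetric] by simp
    then have "n = gform_code (GAnd \<phi> \<chi>)" by (subst n) (simp only: * gform_code.simps)
    then show ?thesis unfolding form_ok_def using \<phi>(2) \<chi>(2) by (intro exI[of _ "GAnd \<phi> \<chi>"]) simp
  qed
qed

lemma decidable_form_ok [tr_intros]:
  assumes "tr f" "tr g" shows "decidable (\<lambda>n. form_ok (f n) (g n))"
proof -
  define F where "F p n h = (of_bool (p1 n = 0 \<and> p2 n = 0 \<or>
      p1 n = 1 \<and> term_ok p (p1 (p2 n)) \<and> term_ok p (p1 (p2 (p2 n))) \<or>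
      p1 n = 2 \<and> h (p2 n) = 1 \<or> p1 n = 3 \<and> h (p1 (p2 n)) = 1 \<and> h (p2 (p2 n)) = 1) :: nat)"
    for p n and h :: "nat \<Rightarrow> nat"
  have "tr (\<lambda>m. of_bool (form_ok (p1 m) (p2 m)))"
  proof (rule tr_course_of_values)
    show "of_bool (form_ok p n) = F p n (\<lambda>n. of_bool (form_ok p n))" for p n
      by (subst form_ok_iff) (simp add: F_def)
    show "F p n h = F p n h'" if "\<And>i. i < n \<Longrightarrow> h i = h' i" for p n h h'
      using that[OF p2_less[of n]] that[OF p12_less[of n]] that[OF p22_less[of n]]
      by (cases "p1 n = 0") (simp_all add: F_def)
    show "tr (\<lambda>m. F (p1 m) (p1 (p2 m)) (\<lambda>i. lnth (p2 (p2 m)) (p1 (p2 m) - Suc i)))"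
      unfolding F_def term_ok_def by (intro tr_intros)
  qed
  then have "decidable (\<lambda>m. form_ok (p1 m) (p2 m))" by (simp add: decidable_def)
  then show ?thesis using assms by (rule decidable_compose2)
qed

section \<open>Testing a candidate on finitely many valuations\<close>

definition list_bound :: "nat \<Rightarrow> nat \<Rightarrow> nat" where
  "list_bound n c = rec_nat 0 (\<lambda>k y. Suc (prod_encode (c, y))) n"

lemma tr_list_bound [tr_intros]:
  assumes "tr f" "tr g" shows "tr (\<lambda>n. list_bound (f n) (g n))"
proof -
  have "tr (\<lambda>m. list_bound (p1 m) (p2 m))" unfolding list_bound_def by (intro tr_intros)
  then show ?thesis using assms by (rule tr_compose2)
qed

lemma prod_encode_mono: "a \<le> a' \<Longrightarrow> b \<le> b' \<Longrightarrow> prod_encode (a, b) \<le> prod_encode (a', b')"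
proof -
  assume *: "a \<le> a'" "b \<le> b'"
  then have "triangle (a + b) \<le> triangle (a' + b')"
    using lift_Suc_mono_le[of triangle "a + b" "a' + b'"] by simp
  then show ?thesis using * by (simp add: prod_encode_def)
qed

text \<open>\<open>list_bound n c\<close> is the code of \<open>n\<close> copies of
  \<open>c\<close>, and pairing is monotone in both components.\<close>

lemma list_encode_le_bound: "\<forall>x\<in>set l. x \<le> c \<Longrightarrow> list_encode l \<le> list_bound (length l) c"
proof (induction l)
  case (Cons x l)
  then show ?case using prod_encode_mono[of x c "list_encode l"] by (simp add: list_bound_def)
qed simp

lemma list_val_exists:
  assumes "\<forall>x<n. \<bar>\<mu> x\<bar> \<le> int b"
  shows "\<exists>w\<le>list_bound n (2 * b). \<forall>x<n. list_val w x = \<mu> x"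
proof (intro exI conjI allI impI)
  let ?l = "map (\<lambda>x. int_encode (\<mu> x)) [0..<n]"
  have enc: "int_encode k \<le> 2 * b" if "\<bar>k\<bar> \<le> int b" for k
    using that by (auto simp: int_encode_def sum_encode_def)
  have "\<forall>x\<in>set ?l. x \<le> 2 * b" using assms enc by simp
  from list_encode_le_bound[OF this] show "list_encode ?l \<le> list_bound n (2 * b)" by simp
  fix x assume "x < n"
  then show "list_val (list_encode ?l) x = \<mu> x"
    unfolding list_val_def by (subst lnth_encode) simp_all
qed

lemma abs_int_decode_le: "\<bar>int_decode k\<bar> \<le> int k"
proof -
  have "odd k \<Longrightarrow> Suc (k div 2) \<le> k" by presburger
  then show ?thesis by (cases "even k") (simp_all add: int_decode_def sum_decode_def)
qed

lemma abs_list_val_le: "\<bar>list_val w x\<bar> \<le> int w"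
proof -
  have "rec_nat w (\<lambda>k y. p2 (y - 1)) i \<le> w" for i
  proof (induction i)
    case (Suc i)
    then show ?case using p2_le[of "rec_nat w (\<lambda>k y. p2 (y - 1)) i - 1"] by simp
  qed simp
  then have "lnth w x \<le> w"
    unfolding lnth_def ldrop_def using p1_le order_trans diff_le_self by meson
  then show ?thesis unfolding list_val_def using abs_int_decode_le[of "lnth w x"] by linarith
qed

abbreviation sat_set :: "nat \<Rightarrow> (nat \<Rightarrow> int) set" where
  "sat_set n \<equiv> {\<nu>. sat_gform \<nu> (dec_form n)}"

text \<open>The absolute value of a gap is at most its own code, hence at most the code in which it
  occurs, so this exceeds all gaps of the rules and of the three formulas.\<close>

definition gap_limit :: "nat \<Rightarrow> nat \<Rightarrow> nat \<Rightarrow> nat \<Rightarrow> nat" where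
  "gap_limit g a b c = g + a + b + c + 1"

text \<open>The bound of \<open>small_representative\<close> at threshold \<open>2 ^ N * M\<close>,
  with the number \<open>N\<close> of variables and the sizes of the constants estimated by
  \<open>g\<close>. The factor 2 comes from \<open>int_encode\<close>, and lists of length
  \<open>g\<close> suffice since all variables are below \<open>g\<close>.\<close>

definition source_bound :: "nat \<Rightarrow> nat \<Rightarrow> nat \<Rightarrow> nat \<Rightarrow> nat" where
  "source_bound g a b c = list_bound g (2 * (g + 2 ^ g * (2 ^ g * gap_limit g a b c)))"

text \<open>The bound of \<open>moves_back_and_forth\<close> for a source whose values are at most
  \<open>source_bound\<close>, this being a bound on its code and so on its entries.\<close>

definition target_bound :: "nat \<Rightarrow> nat \<Rightarrow> nat \<Rightarrow> nat \<Rightarrow> nat" where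
  "target_bound g a b c = list_bound g (2 * (source_bound g a b c + g + 2 ^ g * gap_limit g a b c))"

definition pre_check :: "nat \<Rightarrow> nat \<Rightarrow> nat \<Rightarrow> nat \<Rightarrow> nat \<Rightarrow> bool" where
  "pre_check g al a b c \<longleftrightarrow> (\<forall>w\<le>source_bound g a b c.
     sat_gform (list_val w) (dec_form c) \<longleftrightarrow> sat_gform (list_val w) (dec_form a) \<or>
       (\<exists>w'\<le>target_bound g a b c. moves (rules_of g al) (list_val w) (list_val w') \<and>
          sat_gform (list_val w') (dec_form b)))"

lemma decidable_pre_check [tr_intros]:
  assumes "tr f" "tr k" "tr a" "tr b" "tr c"
  shows "decidable (\<lambda>n. pre_check (f n) (k n) (a n) (b n) (c n))"
proof -
  have "decidable (\<lambda>m. pre_check (p1 m) (p1 (p2 m)) (p1 (p2 (p2 m))) (p1 (p2 (p2 (p2 m)))) (p2 (p2 (p2 (p2 m)))))"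
    unfolding pre_check_def target_bound_def source_bound_def gap_limit_def by (intro tr_intros)
  from decidable_compose[OF this tr_pair[OF assms(1) tr_pair[OF assms(2) tr_pair[OF assms(3) tr_pair[OF assms(4,5)]]]]]
  show ?thesis by simp
qed

lemma form_ok_over: "form_ok g n \<Longrightarrow> gform_over (gvars g) (gconsts g) (dec_form n)"
  by (auto simp: form_ok_def)

lemma gap_bound_dec: "n < m \<Longrightarrow> gap_bound (int m) (dec_clause d n)"
proof -
  assume "n < m"
  moreover have "p2 (p2 n) \<le> n" using p2_le[of n] p2_le[of "p2 n"] by linarith
  ultimately show ?thesis using abs_int_decode_le[of "p2 (p2 n)"] by (simp add: dec_clause_def)
qed

lemma form_bound_dec: "n < m \<Longrightarrow> form_bound (int m) (dec_form n)"
proof (induction n rule: less_induct)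
  case (less n)
  show ?case
  proof (cases "p1 n = 0")
    case True
    then show ?thesis by (subst dec_form.simps) simp
  next
    case False
    note l = p2_less[OF False] p12_less[OF False] p22_less[OF False]
    have "gap_bound (int m) (dec_clause id (p2 n))" using l(1) less.prems by (intro gap_bound_dec) simp
    moreover have "form_bound (int m) (dec_form (p2 n))"
      "form_bound (int m) (dec_form (p1 (p2 n)))" "form_bound (int m) (dec_form (p2 (p2 n)))"
      using l less.prems by (intro less.IH; simp)+
    ultimately show ?thesis by (subst dec_form.simps) simp
  qed
qed

lemma gvars_less: "x \<in> gvars g \<Longrightarrow> x < g"
  using mem_elems_less[of x "p1 g"] p1_le[of g] by linarith

lemma card_gvars: "card (gvars g) \<le> g"
proof -
  have "card (gvars g) \<le> card {..<g}" by (rule card_mono) (auto dest: gvars_less)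
  then show ?thesis by simp
qed

lemma gconsts_le: "c \<in> gconsts g \<Longrightarrow> \<bar>c\<bar> \<le> int g"
proof -
  assume "c \<in> gconsts g"
  then obtain k where k: "c = int_decode k" "k \<in> elems (p1 (p2 g))" by blast
  have "k < g" using mem_elems_less[OF k(2)] p1_le[of "p2 g"] p2_le[of g] by linarith
  then show ?thesis using abs_int_decode_le[of k] k(1) by linarith
qed

lemma rules_of_subset: "rules_of g al \<subseteq> rules_of g 0"
  by (auto simp: rules_of_def)

lemma rules_over_rules_of:
  assumes "sys_ok g" "g \<le> m"
  shows "rules_over (gvars g) (gconsts g) (int m) (rules_of g al)"
  unfolding rules_over_def
proof (intro ballI conjI)
  fix C c assume C: "C \<in> rules_of g al" "c \<in> set C"
  then show "clause_over (Cur ` gvars g \<union> Nxt ` gvars g) (gconsts g) c"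
    using assms(1) rules_of_subset[of g al] unfolding sys_ok_iff by blast
  obtain r where r: "r \<in> elems (grules g)" "C = map (dec_clause dec_tvar) (list_decode (p1 r))"
    using C(1) unfolding rules_of_def by blast
  then obtain n where n: "c = dec_clause dec_tvar n" "n \<in> elems (p1 r)" using C(2) by auto
  have "n < m"
    using mem_elems_less[OF n(2)] mem_elems_less[OF r(1)] p1_le[of r] p2_le[of g] p2_le[of "p2 g"]
      p2_le[of "p2 (p2 g)"] assms(2) by linarith
  then show "gap_bound (int m) c" unfolding n(1) by (rule gap_bound_dec)
qed

lemma list_val_exists_gvars:
  assumes "\<forall>x\<in>gvars g. \<bar>\<mu> x\<bar> \<le> int b"
  shows "\<exists>w\<le>list_bound g (2 * b). \<forall>x\<in>gvars g. list_val w x = \<mu> x"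
proof -
  define \<mu>' where "\<mu>' x = (if x \<in> gvars g then \<mu> x else 0)" for x
  have "\<forall>x<g. \<bar>\<mu>' x\<bar> \<le> int b" using assms by (simp add: \<mu>'_def)
  then obtain w where "w \<le> list_bound g (2 * b)" "\<forall>x<g. list_val w x = \<mu>' x"
    using list_val_exists by blast
  then show ?thesis using gvars_less by (intro exI[of _ w]) (simp add: \<mu>'_def)
qed

text \<open>It suffices to test valuations with small values: each valuation agrees, up to the threshold
  that the predecessor operator needs, with a small one, and then some successor is small as well.\<close>

lemma pre_check_iff:
  assumes g: "sys_ok g" and ok: "form_ok g a" "form_ok g b" "form_ok g c"
  shows "pre_check g al a b c \<longleftrightarrow> sat_set c = sat_set a \<union> Pre (rules_of g al) (sat_set b)"
proof -
  define M where "M = gap_limit g a b c"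
  define N where "N = card (gvars g)"
  \<comment> \<open>The formulas are invariant at \<open>M\<close>, but their predecessors only at
    \<open>T\<close>, so the representatives have to be taken for \<open>T\<close>.\<close>
  define T where "T = 2 ^ N * int M"
  define W where "W = source_bound g a b c"
  let ?X = "gvars g" and ?D = "gconsts g" and ?R = "rules_of g al"
  have fin: "finite ?X" "finite ?D" by simp_all
  have M: "0 < int M" "g \<le> M" "a < M" "b < M" "c < M" by (simp_all add: M_def gap_limit_def)
  have NG: "(2::int) ^ N \<le> 2 ^ g" using card_gvars[of g] by (simp add: N_def)
  have MT: "int M \<le> T" using mult_right_mono[of 1 "2 ^ N" "int M"] by (simp add: T_def)
  have TG: "T \<le> 2 ^ g * int M" using mult_right_mono[OF NG, of "int M"] by (simp add: T_def)
  have R: "rules_over ?X ?D (int M) ?R" by (rule rules_over_rules_of[OF g M(2)])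
  have inv: "invariant ?X ?D (int M) (sat_set n)" if "form_ok g n" "n < M" for n
    using that by (intro invariant_sat form_ok_over form_bound_dec)
  have invP: "invariant ?X ?D T (Pre ?R (sat_set b))"
    unfolding T_def N_def by (rule invariant_Pre[OF fin M(1) R inv[OF ok(2) M(4)]])
  have invL: "invariant ?X ?D T (sat_set c)" "invariant ?X ?D T (sat_set a)"
    using inv[OF ok(3) M(5)] inv[OF ok(1) M(3)] MT by (auto intro: invariant_mono)
  then have invR: "invariant ?X ?D T (sat_set a \<union> Pre ?R (sat_set b))"
    using invP by (intro invariant_Un)
  have post: "(\<exists>w'\<le>target_bound g a b c. moves ?R (list_val w) (list_val w') \<and> sat_gform (list_val w') (dec_form b))
      \<longleftrightarrow> list_val w \<in> Pre ?R (sat_set b)" if w: "w \<le> W" for w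
  proof
    assume "list_val w \<in> Pre ?R (sat_set b)"
    then obtain \<nu>' where \<nu>': "\<nu>' \<in> sat_set b" "moves ?R (list_val w) \<nu>'" by (auto simp: Pre_def)
    \<comment> \<open>Back-and-forth from \<open>list_val w\<close> to itself replaces an arbitrary
      successor by a small one.\<close>
    have ag: "agree ?X ?D (2 ^ card ?X * int M) (list_val w) (list_val w)" by (rule agree_cong) simp
    have "\<forall>x\<in>?X. \<bar>list_val w x\<bar> \<le> int (W + g)"
      using abs_list_val_le[of w] w by (meson le_add1 of_nat_le_iff order_trans)
    moreover have "\<forall>c\<in>?D. \<bar>c\<bar> \<le> int (W + g)"
      using gconsts_le by (meson le_add2 of_nat_le_iff order_trans)
    ultimately obtain \<mu>' where \<mu>': "moves ?R (list_val w) \<mu>'" "agree ?X ?D (int M) \<nu>' \<mu>'"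
      "\<forall>x\<in>?X. \<bar>\<mu>' x\<bar> \<le> int (W + g) + (2 ^ card ?X - 1) * int M"
      using moves_back_and_forth[OF fin M(1) R ag \<nu>'(2), of "int (W + g)"] by auto
    have "int (W + g) + (2 ^ card ?X - 1) * int M \<le> int (W + g + 2 ^ g * M)"
      using TG by (simp add: T_def N_def left_diff_distrib)
    then have "\<forall>x\<in>?X. \<bar>\<mu>' x\<bar> \<le> int (W + g + 2 ^ g * M)" using \<mu>'(3) order_trans by blast
    from list_val_exists_gvars[OF this] obtain w'
      where w': "w' \<le> list_bound g (2 * (W + g + 2 ^ g * M))" "\<forall>x\<in>?X. list_val w' x = \<mu>' x" by blast
    have ag': "agree ?X ?D (int M) \<mu>' (list_val w')" by (rule agree_cong) (simp add: w'(2))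
    have "list_val w' \<in> sat_set b"
      using inv[OF ok(2) M(4)] \<nu>'(1) \<mu>'(2) ag' unfolding invariant_def by blast
    moreover have "moves ?R (list_val w) (list_val w')"
    proof (rule moves_agree[OF R _ \<mu>'(1)], rule agree_cong)
      show "\<forall>x\<in>Cur ` ?X \<union> Nxt ` ?X. oplus (list_val w) \<mu>' x = oplus (list_val w) (list_val w') x"
        using w'(2) by (auto simp: oplus_def)
    qed
    moreover have "w' \<le> target_bound g a b c" using w'(1) by (simp add: target_bound_def W_def M_def)
    ultimately show "\<exists>w'\<le>target_bound g a b c. moves ?R (list_val w) (list_val w') \<and> sat_gform (list_val w') (dec_form b)"
      by blast
  qed (auto simp: Pre_def)
  have rep: "\<exists>w\<le>W. agree ?X ?D T \<nu> (list_val w)" for \<nu>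
  proof -
    have "0 < T" using MT M(1) by linarith
    from small_representative[OF fin this, of "int g" \<nu>] gconsts_le
    obtain \<mu> where \<mu>: "agree ?X ?D T \<nu> \<mu>" "\<forall>x\<in>?X. \<bar>\<mu> x\<bar> \<le> int g + (2 ^ card ?X - 1) * T"
      by auto
    have "2 ^ card ?X * T \<le> 2 ^ g * (2 ^ g * int M)"
      using NG TG \<open>0 < T\<close> unfolding N_def by (intro mult_mono) simp_all
    then have "int g + (2 ^ card ?X - 1) * T \<le> int (g + 2 ^ g * (2 ^ g * M))"
      using \<open>0 < T\<close> by (simp add: left_diff_distrib)
    then have "\<forall>x\<in>?X. \<bar>\<mu> x\<bar> \<le> int (g + 2 ^ g * (2 ^ g * M))" using \<mu>(2) order_trans by blast
    from list_val_exists_gvars[OF this] obtain w where w: "w \<le> W" "\<forall>x\<in>?X. list_val w x = \<mu> x"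
      unfolding W_def source_bound_def M_def by blast
    have "\<forall>x\<in>?X. \<mu> x = list_val w x" using w(2) by simp
    then have "agree ?X ?D T \<mu> (list_val w)" by (rule agree_cong)
    with \<mu>(1) have "agree ?X ?D T \<nu> (list_val w)" by (simp add: agree_def)
    with w(1) show ?thesis by blast
  qed
  have "pre_check g al a b c \<longleftrightarrow>
      (\<forall>w\<le>W. list_val w \<in> sat_set c \<longleftrightarrow> list_val w \<in> sat_set a \<union> Pre ?R (sat_set b))"
    unfolding pre_check_def W_def[symmetric] using post by auto
  also have "\<dots> \<longleftrightarrow> sat_set c = sat_set a \<union> Pre ?R (sat_set b)"
  proof
    assume *: "\<forall>w\<le>W. list_val w \<in> sat_set c \<longleftrightarrow> list_val w \<in> sat_set a \<union> Pre ?R (sat_set b)"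
    show "sat_set c = sat_set a \<union> Pre ?R (sat_set b)"
    proof (rule set_eqI)
      fix \<nu>
      obtain w where w: "w \<le> W" "agree ?X ?D T \<nu> (list_val w)" using rep by blast
      have iff: "\<nu> \<in> A \<longleftrightarrow> list_val w \<in> A" if "invariant ?X ?D T A" for A
        using that w(2) agree_sym[OF w(2)] unfolding invariant_def by blast
      show "\<nu> \<in> sat_set c \<longleftrightarrow> \<nu> \<in> sat_set a \<union> Pre ?R (sat_set b)"
        unfolding iff[OF invL(1)] iff[OF invR] using * w(1) by blast
    qed
  qed blast
  finally show ?thesis .
qed

text \<open>The negated disjunct makes the search terminate on invalid codes, too.\<close>

definition pre_code :: "nat \<Rightarrow> nat \<Rightarrow> nat \<Rightarrow> nat \<Rightarrow> nat" where
  "pre_code g al a b = (LEAST c. \<not> (sys_ok g \<and> form_ok g a \<and> form_ok g b) \<or>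
     form_ok g c \<and> pre_check g al a b c)"

text \<open>Termination rests on \<open>invariant_definable\<close>: some formula defines the set,
  though none is constructed. The threshold here does not involve the candidate, which is not yet
  known.\<close>

lemma pre_code_exists: "\<exists>c. \<not> (sys_ok g \<and> form_ok g a \<and> form_ok g b) \<or> form_ok g c \<and> pre_check g al a b c"
proof (cases "sys_ok g \<and> form_ok g a \<and> form_ok g b")
  case True
  then have g: "sys_ok g" "form_ok g a" "form_ok g b" by simp_all
  define m where "m = g + a + b + 1"
  have m: "0 < int m" "g \<le> m" "a < m" "b < m" by (simp_all add: m_def)
  have "invariant (gvars g) (gconsts g) (int m) (sat_set n)" if "form_ok g n" "n < m" for n
    using that by (intro invariant_sat form_ok_over form_bound_dec)
  note inv = this[OF g(2) m(3)] this[OF g(3) m(4)]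
  have "int m \<le> 2 ^ card (gvars g) * int m" using m(1) by simp
  then have "invariant (gvars g) (gconsts g) (2 ^ card (gvars g) * int m)
      (sat_set a \<union> Pre (rules_of g al) (sat_set b))"
    using invariant_mono[OF inv(1)] invariant_Pre[OF _ _ m(1) rules_over_rules_of[OF g(1) m(2)] inv(2)]
    by (intro invariant_Un) simp_all
  from invariant_definable[OF _ _ this] obtain \<phi> where \<phi>: "gform_over (gvars g) (gconsts g) \<phi>"
    "{\<nu>. sat_gform \<nu> \<phi>} = sat_set a \<union> Pre (rules_of g al) (sat_set b)" by auto
  then have ok: "form_ok g (gform_code \<phi>)" unfolding form_ok_def by blast
  moreover have "pre_check g al a b (gform_code \<phi>)"
    unfolding pre_check_iff[OF g ok] by (simp only: \<phi>(2) dec_form_code)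
  ultimately show ?thesis by blast
qed blast

lemma tr_pre_code [tr_intros]:
  assumes "tr f" "tr k" "tr a" "tr b"
  shows "tr (\<lambda>n. pre_code (f n) (k n) (a n) (b n))"
proof -
  have "tr (\<lambda>m. pre_code (p1 m) (p1 (p2 m)) (p1 (p2 (p2 m))) (p2 (p2 (p2 m))))"
    unfolding pre_code_def by (rule tr_Least) (intro tr_intros, rule pre_code_exists)
  from tr_compose[OF this tr_pair[OF assms(1) tr_pair[OF assms(2) tr_pair[OF assms(3,4)]]]]
  show ?thesis by simp
qed

lemma pre_code_correct:
  assumes "sys_ok g" "form_ok g a" "form_ok g b"
  shows "form_ok g (pre_code g al a b)"
    and "sat_set (pre_code g al a b) = sat_set a \<union> Pre (rules_of g al) (sat_set b)"
proof -
  have *: "form_ok g (pre_code g al a b) \<and> pre_check g al a b (pre_code g al a b)"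
    using LeastI_ex[OF pre_code_exists[of g a b al]] assms unfolding pre_code_def by blast
  then show "form_ok g (pre_code g al a b)" by blast
  from * show "sat_set (pre_code g al a b) = sat_set a \<union> Pre (rules_of g al) (sat_set b)"
    using pre_check_iff[OF assms] by blast
qed

section \<open>Computing the set of valuations that reach a target\<close>

definition pre_iter :: "nat \<Rightarrow> nat \<Rightarrow> nat \<Rightarrow> nat" where
  "pre_iter g b k = rec_nat b (\<lambda>_ y. pre_code g 0 b y) k"

lemma tr_pre_iter [tr_intros]:
  assumes "tr f" "tr b" "tr k"
  shows "tr (\<lambda>n. pre_iter (f n) (b n) (k n))"
proof -
  have "tr (\<lambda>m. pre_iter (p1 m) (p1 (p2 m)) (p2 (p2 m)))"
    unfolding pre_iter_def by (intro tr_intros)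
  then show ?thesis using assms by (rule tr_compose3)
qed

lemma pre_iter_correct:
  assumes "sys_ok g" "form_ok g b"
  shows "form_ok g (pre_iter g b k) \<and> sat_set (pre_iter g b k) = Pre_upto (rules_of g 0) (sat_set b) k"
proof (induction k)
  case 0
  show ?case using assms(2) by (simp add: pre_iter_def)
next
  case (Suc k)
  have S: "pre_iter g b (Suc k) = pre_code g 0 b (pre_iter g b k)" by (simp add: pre_iter_def)
  have ok: "form_ok g (pre_iter g b k)" using Suc by blast
  show ?case
    unfolding S pre_code_correct(2)[OF assms ok] using pre_code_correct(1)[OF assms ok] Suc by simp
qed

text \<open>With the iterate both as target and as candidate, \<open>pre_check\<close> is a test for
  a fixpoint. \<open>Pre_upto_stabilises\<close> guarantees that the search succeeds.\<close>

definition reach_code :: "nat \<Rightarrow> nat \<Rightarrow> nat" where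
  "reach_code g b = pre_iter g b (LEAST k. \<not> (sys_ok g \<and> form_ok g b) \<or>
     pre_check g 0 b (pre_iter g b k) (pre_iter g b k))"

lemma reach_code_exists:
  "\<exists>k. \<not> (sys_ok g \<and> form_ok g b) \<or> pre_check g 0 b (pre_iter g b k) (pre_iter g b k)"
proof (cases "sys_ok g \<and> form_ok g b")
  case True
  then have g: "sys_ok g" "form_ok g b" by simp_all
  define m where "m = g + b + 1"
  have m: "0 < int m" "g \<le> m" "b < m" by (simp_all add: m_def)
  have inv: "invariant (gvars g) (gconsts g) (int m) (sat_set b)"
    using g m by (intro invariant_sat form_ok_over form_bound_dec)
  have pos: "\<forall>C\<in>rules_of g 0. \<forall>c\<in>set C. positive_clause c"
    using g(1) unfolding sys_ok_iff by blast
  obtain k where "Pre_upto (rules_of g 0) (sat_set b) (Suc k) = Pre_upto (rules_of g 0) (sat_set b) k"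
    using Pre_upto_stabilises[OF _ _ m(1) rules_over_rules_of[OF g(1) m(2)] pos inv] by auto
  moreover note it = pre_iter_correct[OF g, of k]
  ultimately have "pre_check g 0 b (pre_iter g b k) (pre_iter g b k)"
    unfolding pre_check_iff[OF g conjunct1[OF it] conjunct1[OF it]] by simp
  then show ?thesis by blast
qed blast

lemma tr_reach_code [tr_intros]:
  assumes "tr f" "tr b" shows "tr (\<lambda>n. reach_code (f n) (b n))"
proof -
  have "tr (\<lambda>n. LEAST k. \<not> (sys_ok (p1 n) \<and> form_ok (p1 n) (p2 n)) \<or>
     pre_check (p1 n) 0 (p2 n) (pre_iter (p1 n) (p2 n) k) (pre_iter (p1 n) (p2 n) k))"
    by (rule tr_Least) (intro tr_intros, rule reach_code_exists)
  then have "tr (\<lambda>n. reach_code (p1 n) (p2 n))"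
    unfolding reach_code_def by (intro tr_intros)
  then show ?thesis using assms by (rule tr_compose2)
qed

lemma reach_code_correct:
  assumes "sys_ok g" "form_ok g b"
  shows "form_ok g (reach_code g b)"
    and "sat_set (reach_code g b) = {\<nu>. \<exists>\<kappa>\<in>sat_set b. (moves (rules_of g 0))\<^sup>*\<^sup>* \<nu> \<kappa>}"
proof -
  define k where "k = (LEAST k. \<not> (sys_ok g \<and> form_ok g b) \<or>
     pre_check g 0 b (pre_iter g b k) (pre_iter g b k))"
  have check: "pre_check g 0 b (pre_iter g b k) (pre_iter g b k)"
    using LeastI_ex[OF reach_code_exists[of g b]] assms unfolding k_def by blast
  have eq: "reach_code g b = pre_iter g b k" by (simp add: reach_code_def k_def)
  note it = pre_iter_correct[OF assms, of k]
  show "form_ok g (reach_code g b)" unfolding eq using it by blast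
  have "sat_set b \<union> Pre (rules_of g 0) (Pre_upto (rules_of g 0) (sat_set b) k) =
      Pre_upto (rules_of g 0) (sat_set b) k"
    using check unfolding pre_check_iff[OF assms conjunct1[OF it] conjunct1[OF it]] conjunct2[OF it]
    by (rule sym)
  from Pre_upto_fixpoint[OF this] show "sat_set (reach_code g b) = {\<nu>. \<exists>\<kappa>\<in>sat_set b. (moves (rules_of g 0))\<^sup>*\<^sup>* \<nu> \<kappa>}"
    unfolding eq conjunct2[OF it] by blast
qed

text \<open>Clauses have the same payload in both logics, only the tag changes.
  \<open>prod_encode (2, 0)\<close> codes \<open>GNot GTrue\<close>, so the diamond is a predecessor
  step with nothing added; \<open>Suc (p1 (p2 n))\<close> selects the rules with its action. The
  last branch covers \<open>ETrue\<close>, as 0 is the code of \<open>GTrue\<close>.\<close>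

function ef_form :: "nat \<Rightarrow> nat \<Rightarrow> nat" where
  "ef_form g n =
    (if p1 n = 0 then prod_encode (1, p2 n)
     else if p1 n = 2 then prod_encode (2, ef_form g (p2 n))
     else if p1 n = 3 then prod_encode (3, prod_encode (ef_form g (p1 (p2 n)), ef_form g (p2 (p2 n))))
     else if p1 n = 4 then pre_code g (Suc (p1 (p2 n))) (prod_encode (2, 0)) (ef_form g (p2 (p2 n)))
     else if p1 n = 5 then reach_code g (ef_form g (p2 n))
     else 0)"
  by pat_completeness auto

termination
  by (relation "measure snd") (simp_all add: p2_less p12_less p22_less)

declare ef_form.simps [simp del]

lemma tr_ef_form: "tr (\<lambda>m. ef_form (p1 m) (p2 m))"
proof -
  define F where "F g n h =
    (if p1 n = 0 then prod_encode (1, p2 n)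
     else if p1 n = 2 then prod_encode (2, h (p2 n))
     else if p1 n = 3 then prod_encode (3, prod_encode (h (p1 (p2 n)), h (p2 (p2 n))))
     else if p1 n = 4 then pre_code g (Suc (p1 (p2 n))) (prod_encode (2, 0)) (h (p2 (p2 n)))
     else if p1 n = 5 then reach_code g (h (p2 n))
     else 0)" for g n and h :: "nat \<Rightarrow> nat"
  show ?thesis
  proof (rule tr_course_of_values)
    show "ef_form p n = F p n (ef_form p)" for p n
      by (subst ef_form.simps) (simp only: F_def)
    show "F p n h = F p n h'" if "\<And>i. i < n \<Longrightarrow> h i = h' i" for p n h h'
      using that[OF p2_less[of n]] that[OF p12_less[of n]] that[OF p22_less[of n]]
      by (cases "p1 n = 0") (simp_all add: F_def)
    show "tr (\<lambda>m. F (p1 m) (p1 (p2 m)) (\<lambda>i. lnth (p2 (p2 m)) (p1 (p2 m) - Suc i)))"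
      unfolding F_def by (intro tr_intros)
  qed
qed

lemma codes_gcs_decode:
  assumes "is_gcs G" "codes_gcs g G"
  shows "gvars g = vars G" and "gconsts g = constants G" and "rules_of g 0 = rules G"
    and "rules_of g (Suc a) = {C \<in> rules G. label G C = a}" and "sys_ok g"
proof -
  obtain xs cs as Cs where *: "set xs = vars G" "set cs = constants G" "set Cs = rules G"
    "g = prod_encode (list_encode xs, prod_encode (list_encode (map int_encode cs),
       prod_encode (list_encode as, list_encode (map (\<lambda>C. prod_encode (tconstraint_code C, label G C)) Cs))))"
    using assms(2) unfolding codes_gcs_def by blast
  show X: "gvars g = vars G" by (simp add: *)
  show D: "gconsts g = constants G" by (simp add: * image_image)
  have dec: "map (dec_clause dec_tvar) (list_decode (tconstraint_code C)) = C" for C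
    by (simp add: tconstraint_code_def dec_clause_code[OF dec_tvar_code] map_idI)
  have "{r \<in> elems (grules g). al = 0 \<or> al = Suc (p2 r)} =
      (\<lambda>C. prod_encode (tconstraint_code C, label G C)) ` {C \<in> rules G. al = 0 \<or> al = Suc (label G C)}" for al
    by (auto simp: *(4) *(3)[symmetric])
  then have R: "rules_of g al = {C \<in> rules G. al = 0 \<or> al = Suc (label G C)}" for al
    by (simp add: rules_of_def image_image dec)
  show "rules_of g 0 = rules G" "rules_of g (Suc a) = {C \<in> rules G. label G C = a}"
    unfolding R by auto
  show "sys_ok g"
    unfolding sys_ok_iff X D \<open>rules_of g 0 = rules G\<close> using assms(1) unfolding is_gcs_def by blast
qed

text \<open>Rules mention only variables of the system, so restricting every valuation of a run
  again gives a run. The assumption on \<open>S\<close> keeps its endpoint in the target.\<close>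

lemma reach_iff:
  assumes G: "is_gcs G" and S: "\<And>\<kappa> \<kappa>'. \<forall>x\<in>vars G. \<kappa> x = \<kappa>' x \<Longrightarrow> \<kappa> \<in> S \<Longrightarrow> \<kappa>' \<in> S" and \<nu>: "\<nu> \<in> Val (vars G)"
  shows "(\<exists>\<kappa>\<in>S. (moves (rules G))\<^sup>*\<^sup>* \<nu> \<kappa>) \<longleftrightarrow> (\<exists>\<kappa>\<in>S \<inter> Val (vars G). reach G \<nu> \<kappa>)"
proof
  let ?r = "\<lambda>\<kappa>. restrict \<kappa> (vars G)"
  let ?s = "\<lambda>\<nu> \<nu>'. \<exists>a\<in>acts G. step G a \<nu> \<nu>'"
  have r: "?r \<kappa> \<in> Val (vars G)" for \<kappa> by (simp add: Val_def)
  have sat: "sat_clause (oplus \<kappa> \<kappa>') c \<Longrightarrow> sat_clause (oplus (?r \<kappa>) (?r \<kappa>')) c"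
    if "clause_over (Cur ` vars G \<union> Nxt ` vars G) (constants G) c" for \<kappa> \<kappa>' c
  proof -
    have "\<forall>x\<in>Cur ` vars G \<union> Nxt ` vars G. oplus \<kappa> \<kappa>' x = oplus (?r \<kappa>) (?r \<kappa>') x"
      by (auto simp: oplus_def)
    note tv = term_val_cong[OF this]
    obtain s t k where c: "c = Gap s t k" by (cases c)
    have "term_val (oplus \<kappa> \<kappa>') s = term_val (oplus (?r \<kappa>) (?r \<kappa>')) s"
      "term_val (oplus \<kappa> \<kappa>') t = term_val (oplus (?r \<kappa>) (?r \<kappa>')) t"
      using that tv unfolding c by auto
    then show "sat_clause (oplus \<kappa> \<kappa>') c \<Longrightarrow> sat_clause (oplus (?r \<kappa>) (?r \<kappa>')) c"
      unfolding c by (simp only: sat_clause.simps)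
  qed
  have st: "?s (?r \<kappa>) (?r \<kappa>')" if m: "moves (rules G) \<kappa> \<kappa>'" for \<kappa> \<kappa>'
  proof -
    obtain C where C: "C \<in> rules G" "sat_constraint (oplus \<kappa> \<kappa>') C" using m unfolding moves_def by blast
    then have "sat_constraint (oplus (?r \<kappa>) (?r \<kappa>')) C"
      using G sat unfolding is_gcs_def sat_constraint_def by blast
    moreover have "label G C \<in> acts G" using G C(1) unfolding is_gcs_def by blast
    ultimately show ?thesis using C(1) r unfolding step_def by blast
  qed
  assume "\<exists>\<kappa>\<in>S. (moves (rules G))\<^sup>*\<^sup>* \<nu> \<kappa>"
  then obtain \<kappa> where \<kappa>: "\<kappa> \<in> S" "(moves (rules G))\<^sup>*\<^sup>* \<nu> \<kappa>" by blast
  from \<kappa>(2) have "?s\<^sup>*\<^sup>* (?r \<nu>) (?r \<kappa>)"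
  proof (induction rule: rtranclp_induct)
    case (step y z)
    from step.IH st[OF step.hyps(2)] show ?case by - (rule rtranclp.rtrancl_into_rtrancl)
  qed simp
  moreover have "?r \<nu> = \<nu>" using \<nu> by (simp add: Val_def PiE_def extensional_restrict)
  moreover have "?r \<kappa> \<in> S" by (rule S[OF _ \<kappa>(1)]) simp
  ultimately show "\<exists>\<kappa>\<in>S \<inter> Val (vars G). reach G \<nu> \<kappa>"
    unfolding reach_def using r[of \<kappa>] by auto
next
  assume "\<exists>\<kappa>\<in>S \<inter> Val (vars G). reach G \<nu> \<kappa>"
  then obtain \<kappa> where \<kappa>: "\<kappa> \<in> S" "(\<lambda>\<nu> \<nu>'. \<exists>a\<in>acts G. step G a \<nu> \<nu>')\<^sup>*\<^sup>* \<nu> \<kappa>"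
    unfolding reach_def by blast
  have mv: "step G a \<mu> \<mu>' \<Longrightarrow> moves (rules G) \<mu> \<mu>'" for a \<mu> \<mu>'
    unfolding step_def moves_def by blast
  from \<kappa>(2) have "(moves (rules G))\<^sup>*\<^sup>* \<nu> \<kappa>"
  proof (induction rule: rtranclp_induct)
    case (step y z)
    from step.hyps(2) obtain a where "step G a y z" by blast
    from step.IH mv[OF this] show ?case by - (rule rtranclp.rtrancl_into_rtrancl)
  qed simp
  then show "\<exists>\<kappa>\<in>S. (moves (rules G))\<^sup>*\<^sup>* \<nu> \<kappa>" using \<kappa>(1) by blast
qed

lemma ef_form_correct:
  assumes G: "is_gcs G" "codes_gcs g G"
  shows "ef_over G \<psi> \<Longrightarrow> form_ok g (ef_form g (ef_code \<psi>)) \<and>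
    (\<forall>\<nu>\<in>Val (vars G). sat_gform \<nu> (dec_form (ef_form g (ef_code \<psi>))) \<longleftrightarrow> \<nu> \<in> sem G \<psi>)"
proof (induction \<psi>)
  case (EClause c)
  have eq: "ef_form g (ef_code (EClause c)) = gform_code (GClause c)" by (subst ef_form.simps) simp
  have "form_ok g (gform_code (GClause c))"
    unfolding form_ok_def using EClause by (intro exI[of _ "GClause c"]) (simp add: codes_gcs_decode[OF G])
  then show ?case unfolding eq dec_form_code by simp
next
  case ETrue
  have "prod_encode (0, 0) = 0" by (simp add: prod_encode_def)
  then have eq: "ef_form g (ef_code ETrue) = gform_code GTrue"
    by (subst ef_form.simps) simp
  have "form_ok g (gform_code GTrue)"
    unfolding form_ok_def by (intro exI[of _ GTrue]) simp
  then show ?case unfolding eq dec_form_code by simp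
next
  case (ENot \<psi>)
  then obtain \<phi> where \<phi>: "ef_form g (ef_code \<psi>) = gform_code \<phi>" "gform_over (gvars g) (gconsts g) \<phi>"
    unfolding form_ok_def by auto
  have eq: "ef_form g (ef_code (ENot \<psi>)) = gform_code (GNot \<phi>)"
    by (subst ef_form.simps) (simp add: \<phi>(1))
  have "form_ok g (gform_code (GNot \<phi>))"
    unfolding form_ok_def using \<phi>(2) by (intro exI[of _ "GNot \<phi>"]) simp
  then show ?case using ENot unfolding eq \<phi>(1) dec_form_code by simp
next
  case (EAnd \<psi> \<psi>')
  then obtain \<phi> where \<phi>: "ef_form g (ef_code \<psi>) = gform_code \<phi>" "gform_over (gvars g) (gconsts g) \<phi>"
    unfolding form_ok_def by auto
  from EAnd obtain \<chi> where \<chi>: "ef_form g (ef_code \<psi>') = gform_code \<chi>" "gform_over (gvars g) (gconsts g) \<chi>"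
    unfolding form_ok_def by auto
  have eq: "ef_form g (ef_code (EAnd \<psi> \<psi>')) = gform_code (GAnd \<phi> \<chi>)"
    by (subst ef_form.simps) (simp add: \<phi>(1) \<chi>(1))
  have "form_ok g (gform_code (GAnd \<phi> \<chi>))"
    unfolding form_ok_def using \<phi>(2) \<chi>(2) by (intro exI[of _ "GAnd \<phi> \<chi>"]) simp
  then show ?case using EAnd unfolding eq \<phi>(1) \<chi>(1) dec_form_code by simp
next
  case (EDia a \<psi>)
  let ?b = "ef_form g (ef_code \<psi>)"
  have b: "form_ok g ?b" using EDia by simp
  have "prod_encode (0, 0) = 0" by (simp add: prod_encode_def)
  then have 0: "prod_encode (2, 0) = gform_code (GNot GTrue)" by simp
  have ok0: "form_ok g (prod_encode (2, 0))"
    unfolding form_ok_def 0 by (intro exI[of _ "GNot GTrue"]) simp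
  have empty: "sat_set (prod_encode (2, 0)) = {}" unfolding 0 dec_form_code by simp
  have eq: "ef_form g (ef_code (EDia a \<psi>)) = pre_code g (Suc a) (prod_encode (2, 0)) ?b"
    by (subst ef_form.simps) simp
  note pc = pre_code_correct[OF codes_gcs_decode(5)[OF G] ok0 b, of "Suc a"]
  have "sat_gform \<nu> (dec_form (ef_form g (ef_code (EDia a \<psi>)))) \<longleftrightarrow> \<nu> \<in> sem G (EDia a \<psi>)"
    if \<nu>: "\<nu> \<in> Val (vars G)" for \<nu>
  proof -
    have "sat_gform \<nu> (dec_form (ef_form g (ef_code (EDia a \<psi>)))) \<longleftrightarrow>
        (\<exists>\<nu>'\<in>sat_set ?b. moves {C \<in> rules G. label G C = a} \<nu> \<nu>')"
      using pc(2) unfolding empty eq codes_gcs_decode(4)[OF G] Pre_def by blast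
    also have "\<dots> \<longleftrightarrow> (\<exists>\<nu>'\<in>sem G \<psi>. step G a \<nu> \<nu>')"
    proof
      assume "\<exists>\<nu>'\<in>sat_set ?b. moves {C \<in> rules G. label G C = a} \<nu> \<nu>'"
      then obtain \<nu>' where \<nu>': "\<nu>' \<in> sat_set ?b" "moves {C \<in> rules G. label G C = a} \<nu> \<nu>'" by blast
      \<comment> \<open>The successor found may be any function; its restriction is a proper
        valuation that rules and formulas cannot distinguish from it.\<close>
      define \<mu> where "\<mu> = restrict \<nu>' (vars G)"
      have \<mu>: "\<mu> \<in> Val (vars G)" "\<forall>x\<in>vars G. \<nu>' x = \<mu> x" by (simp_all add: \<mu>_def Val_def)
      have "sat_gform \<mu> (dec_form ?b)"
        using \<nu>'(1) sat_gform_agree[OF agree_cong[OF \<mu>(2)] _ form_bound_dec[OF lessI]]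
          form_ok_over[OF b] unfolding codes_gcs_decode[OF G] by blast
      then have "\<mu> \<in> sem G \<psi>" using EDia \<mu>(1) by simp
      moreover have "\<forall>x\<in>Cur ` vars G \<union> Nxt ` vars G. oplus \<nu> \<nu>' x = oplus \<nu> \<mu> x"
        using \<mu>(2) by (auto simp: oplus_def)
      then have "moves (rules_of g (Suc a)) \<nu> \<mu>"
        using moves_agree[OF rules_over_rules_of[OF codes_gcs_decode(5)[OF G] order_refl]
            agree_cong, of \<nu> \<nu>' \<nu> \<mu> "Suc a"] \<nu>'(2)
        unfolding codes_gcs_decode[OF G] by blast
      then have "step G a \<nu> \<mu>"
        unfolding step_def moves_def codes_gcs_decode(4)[OF G] using \<nu> \<mu>(1) by blast
      ultimately show "\<exists>\<nu>'\<in>sem G \<psi>. step G a \<nu> \<nu>'" by blast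
    next
      assume "\<exists>\<nu>'\<in>sem G \<psi>. step G a \<nu> \<nu>'"
      then obtain \<nu>' where \<nu>': "\<nu>' \<in> sem G \<psi>" "step G a \<nu> \<nu>'" by blast
      then have "\<nu>' \<in> sat_set ?b" using EDia unfolding step_def by simp
      moreover have "moves {C \<in> rules G. label G C = a} \<nu> \<nu>'"
        using \<nu>'(2) unfolding step_def moves_def by blast
      ultimately show "\<exists>\<nu>'\<in>sat_set ?b. moves {C \<in> rules G. label G C = a} \<nu> \<nu>'" by blast
    qed
    finally show ?thesis using \<nu> by simp
  qed
  then show ?case using pc(1) unfolding eq by blast
next
  case (EF \<psi>)
  let ?b = "ef_form g (ef_code \<psi>)"
  have b: "form_ok g ?b" using EF by simp
  have eq: "ef_form g (ef_code (ef.EF \<psi>)) = reach_code g ?b"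
    by (subst ef_form.simps) simp
  note rc = reach_code_correct[OF codes_gcs_decode(5)[OF G] b]
  have cong: "\<kappa>' \<in> sat_set ?b" if "\<forall>x\<in>vars G. \<kappa> x = \<kappa>' x" "\<kappa> \<in> sat_set ?b" for \<kappa> \<kappa>'
    using that(2) sat_gform_agree[OF agree_cong[OF that(1)] _ form_bound_dec[OF lessI]]
      form_ok_over[OF b] unfolding codes_gcs_decode[OF G] by blast
  have val: "reach G \<nu> \<kappa> \<Longrightarrow> \<nu> \<in> Val (vars G) \<Longrightarrow> \<kappa> \<in> Val (vars G)" for \<nu> \<kappa>
    unfolding reach_def by (induction rule: rtranclp_induct) (auto simp: step_def)
  have "sat_gform \<nu> (dec_form (ef_form g (ef_code (ef.EF \<psi>)))) \<longleftrightarrow> \<nu> \<in> sem G (ef.EF \<psi>)"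
    if \<nu>: "\<nu> \<in> Val (vars G)" for \<nu>
  proof -
    have "sat_gform \<nu> (dec_form (ef_form g (ef_code (ef.EF \<psi>)))) \<longleftrightarrow>
        (\<exists>\<kappa>\<in>sat_set ?b. (moves (rules G))\<^sup>*\<^sup>* \<nu> \<kappa>)"
      using rc(2) unfolding eq codes_gcs_decode(3)[OF G] by blast
    also have "\<dots> \<longleftrightarrow> (\<exists>\<kappa>\<in>sat_set ?b \<inter> Val (vars G). reach G \<nu> \<kappa>)"
      by (rule reach_iff[OF G(1) cong \<nu>])
    also have "\<dots> \<longleftrightarrow> (\<exists>\<kappa>\<in>sem G \<psi> \<inter> Val (vars G). reach G \<nu> \<kappa>)" using EF by auto
    also have "\<dots> \<longleftrightarrow> (\<exists>\<kappa>\<in>sem G \<psi>. reach G \<nu> \<kappa>)" using val[OF _ \<nu>] by blast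
    finally show ?thesis using \<nu> by simp
  qed
  then show ?case using rc(1) unfolding eq by blast
qed

theorem theorem2:
  shows "(\<exists>d. total_recursive d \<and>
      (\<forall>(G :: (nat, nat) gcs) (\<nu> :: nat \<Rightarrow> int) (\<psi> :: (nat, nat) ef) (g :: nat) (v :: nat).
         is_gcs G \<and> \<nu> \<in> Val (vars G) \<and> ef_over G \<psi> \<and> codes_gcs g G \<and> codes_val v (vars G) \<nu> \<longrightarrow>
         d (prod_encode (g, prod_encode (v, ef_code \<psi>))) = (if \<nu> \<in> sem G \<psi> then 1 else 0)))
    \<and> (\<exists>f. total_recursive f \<and>
      (\<forall>(G :: (nat, nat) gcs) (\<psi> :: (nat, nat) ef) (g :: nat).
         is_gcs G \<and> ef_over G \<psi> \<and> codes_gcs g G \<longrightarrow>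
         (\<exists>\<phi> :: nat gform. gform_over (vars G) (constants G) \<phi> \<and>
            f (prod_encode (g, ef_code \<psi>)) = gform_code \<phi> \<and>
            Sat (vars G) \<phi> = sem G \<psi>)))"
proof (rule conjI; rule exI; intro conjI allI impI)
  \<comment> \<open>Model checking is the evaluation of the computed formula at the valuation read
    from the input; that valuation need only be right on the variables of the system.\<close>
  let ?d = "\<lambda>m. of_bool (sat_gform (\<lambda>x. int_decode (lookup (p1 (p2 m)) x)) (dec_form (ef_form (p1 m) (p2 (p2 m)))))"
  have "tr (\<lambda>m. ef_form (p1 m) (p2 (p2 m)))"
    by (rule tr_compose2[OF tr_ef_form]) (intro tr_intros)+
  then have "decidable (\<lambda>m. sat_gform (\<lambda>x. int_decode (lookup (p1 (p2 m)) x)) (dec_form (ef_form (p1 m) (p2 (p2 m)))))"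
    by (intro decidable_compose2[OF decidable_sat_lookup] tr_intros)
  then show "tr ?d" by (rule tr_of_bool)
  fix G :: "(nat, nat) gcs" and \<nu> :: "nat \<Rightarrow> int" and \<psi> :: "(nat, nat) ef" and g v :: nat
  assume *: "is_gcs G \<and> \<nu> \<in> Val (vars G) \<and> ef_over G \<psi> \<and> codes_gcs g G \<and> codes_val v (vars G) \<nu>"
  let ?b = "ef_form g (ef_code \<psi>)"
  have b: "form_ok g ?b" "sat_gform \<nu> (dec_form ?b) \<longleftrightarrow> \<nu> \<in> sem G \<psi>"
    using ef_form_correct[of G g \<psi>] * by blast+
  have "\<forall>x\<in>gvars g. int_decode (lookup v x) = \<nu> x"
    using lookup_code[of v "vars G" \<nu>] codes_gcs_decode(1)[of G g] * by blast
  then have "sat_gform (\<lambda>x. int_decode (lookup v x)) (dec_form ?b) \<longleftrightarrow> sat_gform \<nu> (dec_form ?b)"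
    by (rule sat_gform_agree[OF agree_cong form_ok_over[OF b(1)] form_bound_dec[OF lessI]])
  then show "?d (prod_encode (g, prod_encode (v, ef_code \<psi>))) = (if \<nu> \<in> sem G \<psi> then 1 else 0)"
    using b(2) by simp
next
  show "tr (\<lambda>m. ef_form (p1 m) (p2 m))" by (rule tr_ef_form)
  fix G :: "(nat, nat) gcs" and \<psi> :: "(nat, nat) ef" and g :: nat
  assume *: "is_gcs G \<and> ef_over G \<psi> \<and> codes_gcs g G"
  then have b: "form_ok g (ef_form g (ef_code \<psi>))"
    "\<forall>\<nu>\<in>Val (vars G). sat_gform \<nu> (dec_form (ef_form g (ef_code \<psi>))) \<longleftrightarrow> \<nu> \<in> sem G \<psi>"
    using ef_form_correct[of G g \<psi>] by blast+
  obtain \<phi> where \<phi>: "ef_form g (ef_code \<psi>) = gform_code \<phi>" "gform_over (gvars g) (gconsts g) \<phi>"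
    using b(1) unfolding form_ok_def by blast
  have "sem G \<psi> \<subseteq> Val (vars G)" by (induction \<psi>) auto
  then have "Sat (vars G) \<phi> = sem G \<psi>"
    using b(2) unfolding \<phi>(1) dec_form_code Sat_def by blast
  moreover have "gform_over (vars G) (constants G) \<phi>"
    using \<phi>(2) codes_gcs_decode(1,2)[of G g] * by simp
  ultimately show "\<exists>\<phi>. gform_over (vars G) (constants G) \<phi> \<and>
      ef_form (p1 (prod_encode (g, ef_code \<psi>))) (p2 (prod_encode (g, ef_code \<psi>))) = gform_code \<phi> \<and>
      Sat (vars G) \<phi> = sem G \<psi>"
    using \<phi>(1) by auto
qed

end
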